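(* Suppose $\kappa$ is strongly compact and $M$ is a transitive class model of set theory with the $\kappa$-cover property. Then the following are equivalent: (1) $M$ has the $\kappa$-approximation property; (2) for every $\kappa$-complete ultrafilter $U$ over a set $X\in M$, $U\cap M\in M$ (i.e. $U$ extends an ultrafilter of $M$).
   Context: $M$ has the $\kappa$-cover property if every $\sigma\subseteq M$ with $|\sigma|<\kappa$ is contained in some $\tau\in M$ with $|\tau|<\kappa$. $M$ has the $\kappa$-approximation property if every $A\subseteq M$ such that $A\cap\sigma\in M$ for all $\sigma\in M$ with $|\sigma|<\kappa$ belongs to $M$. $\kappa$ is strongly compact if for every $\lambda\ge\kappa$ there is a $\kappa$-complete fine ultrafilter over $P_\kappa(\lambda)$. *)

theory Defs
  imports Main
begin

text \<open>
  The universe of sets is an arbitrary model \<open>(V, mem)\<close> of first-order ZFC, where \<open>V\<close> is a type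
  and \<open>mem x y\<close> reads ``x is an element of y''.  The axiom schemas range over genuine first-order
  formulas.  Quantifying over all HOL predicates instead would restrict \<open>V\<close> to models of
  second-order ZFC, and for an inner model \<open>M\<close> it would force \<open>M = V\<close>.

  Formulas use de Bruijn indices.  The atom \<open>Cls\<close> is a unary predicate symbol for a class.
\<close>

datatype fm = Mem nat nat | Eq nat nat | Cls nat | Neg fm | Conj fm fm | All fm

primrec sat :: "'v set \<Rightarrow> ('v \<Rightarrow> 'v \<Rightarrow> bool) \<Rightarrow> 'v set \<Rightarrow> fm \<Rightarrow> (nat \<Rightarrow> 'v) \<Rightarrow> bool" where
  "sat D mem C (Mem i j) e \<longleftrightarrow> mem (e i) (e j)"
| "sat D mem C (Eq i j) e \<longleftrightarrow> e i = e j"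
| "sat D mem C (Cls i) e \<longleftrightarrow> e i \<in> C"
| "sat D mem C (Neg \<phi>) e \<longleftrightarrow> \<not> sat D mem C \<phi> e"
| "sat D mem C (Conj \<phi> \<psi>) e \<longleftrightarrow> sat D mem C \<phi> e \<and> sat D mem C \<psi> e"
| "sat D mem C (All \<phi>) e \<longleftrightarrow> (\<forall>a\<in>D. sat D mem C \<phi> (case_nat a e))"

text \<open>
  \<open>ZFC D mem C\<close>: the structure with domain \<open>D\<close>, membership \<open>mem\<close> and class predicate \<open>C\<close> satisfies
  ZFC, with Separation and Replacement for all formulas of the language with \<open>mem\<close> and \<open>Cls\<close>, and
  with parameters from \<open>D\<close>.  With \<open>C = {}\<close> the atom \<open>Cls\<close> is always false, and this is plain ZFC.
  If \<open>C\<close> is definable from parameters over a model of plain ZFC, then \<open>ZFC D mem C\<close> holds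
  automatically; it also holds for the classes of a model of NBG with choice.
\<close>

definition ZFC :: "'v set \<Rightarrow> ('v \<Rightarrow> 'v \<Rightarrow> bool) \<Rightarrow> 'v set \<Rightarrow> bool" where
  "ZFC D mem C \<longleftrightarrow>
    \<comment> \<open>Extensionality\<close>
    (\<forall>x\<in>D. \<forall>y\<in>D. (\<forall>z\<in>D. mem z x \<longleftrightarrow> mem z y) \<longrightarrow> x = y) \<and>
    \<comment> \<open>Foundation\<close>
    (\<forall>x\<in>D. (\<exists>y\<in>D. mem y x) \<longrightarrow> (\<exists>y\<in>D. mem y x \<and> \<not> (\<exists>z\<in>D. mem z x \<and> mem z y))) \<and>
    \<comment> \<open>Pairing\<close>
    (\<forall>x\<in>D. \<forall>y\<in>D. \<exists>p\<in>D. \<forall>z\<in>D. mem z p \<longleftrightarrow> z = x \<or> z = y) \<and>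
    \<comment> \<open>Union\<close>
    (\<forall>x\<in>D. \<exists>u\<in>D. \<forall>z\<in>D. mem z u \<longleftrightarrow> (\<exists>y\<in>D. mem y x \<and> mem z y)) \<and>
    \<comment> \<open>Power set\<close>
    (\<forall>x\<in>D. \<exists>p\<in>D. \<forall>z\<in>D. mem z p \<longleftrightarrow> (\<forall>w\<in>D. mem w z \<longrightarrow> mem w x)) \<and>
    \<comment> \<open>Infinity\<close>
    (\<exists>w\<in>D. (\<exists>n\<in>D. mem n w \<and> (\<forall>z\<in>D. \<not> mem z n)) \<and>
       (\<forall>x\<in>D. mem x w \<longrightarrow> (\<exists>s\<in>D. mem s w \<and> (\<forall>z\<in>D. mem z s \<longleftrightarrow> mem z x \<or> z = x)))) \<and>
    \<comment> \<open>Separation\<close>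
    (\<forall>\<phi> e. range e \<subseteq> D \<longrightarrow>
       (\<forall>x\<in>D. \<exists>y\<in>D. \<forall>z\<in>D. mem z y \<longleftrightarrow> mem z x \<and> sat D mem C \<phi> (case_nat z e))) \<and>
    \<comment> \<open>Replacement\<close>
    (\<forall>\<phi> e. range e \<subseteq> D \<longrightarrow>
       (\<forall>x\<in>D. (\<forall>u\<in>D. mem u x \<longrightarrow>
                  (\<exists>!v. v \<in> D \<and> sat D mem C \<phi> (case_nat u (case_nat v e)))) \<longrightarrow>
          (\<exists>y\<in>D. \<forall>v\<in>D. mem v y \<longleftrightarrow>
             (\<exists>u\<in>D. mem u x \<and> sat D mem C \<phi> (case_nat u (case_nat v e)))))) \<and>
    \<comment> \<open>Choice: every family of pairwise disjoint nonempty sets has a transversal\<close>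
    (\<forall>F\<in>D. (\<forall>x\<in>D. mem x F \<longrightarrow> (\<exists>z\<in>D. mem z x)) \<and>
        (\<forall>x\<in>D. \<forall>y\<in>D. mem x F \<and> mem y F \<and> x \<noteq> y \<longrightarrow> \<not> (\<exists>z\<in>D. mem z x \<and> mem z y)) \<longrightarrow>
        (\<exists>t\<in>D. \<forall>x\<in>D. mem x F \<longrightarrow> (\<exists>!z. z \<in> D \<and> mem z x \<and> mem z t)))"

text \<open>
  All notions in this locale are evaluated in \<open>V\<close>.  HOL sets of type \<open>'v set\<close> serve as collections
  of elements of \<open>V\<close>; a collection is a set of \<open>V\<close> only if it has the form \<open>elts x\<close>.
\<close>

locale membership =
  fixes mem :: "'v \<Rightarrow> 'v \<Rightarrow> bool"
begin

definition elts :: "'v \<Rightarrow> 'v set" where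
  "elts x = {y. mem y x}"

definition belongs :: "'v set \<Rightarrow> 'v set \<Rightarrow> bool" where
  "belongs S N \<longleftrightarrow> (\<exists>y\<in>N. elts y = S)"

definition transitive_class :: "'v set \<Rightarrow> bool" where
  "transitive_class N \<longleftrightarrow> (\<forall>x\<in>N. elts x \<subseteq> N)"

definition proper_class :: "'v set \<Rightarrow> bool" where
  "proper_class N \<longleftrightarrow> \<not> belongs N UNIV"

text \<open>Kuratowski pairs.\<close>

definition is_pair :: "'v \<Rightarrow> 'v \<Rightarrow> 'v \<Rightarrow> bool" where
  "is_pair p a b \<longleftrightarrow> (\<exists>s t. elts s = {a} \<and> elts t = {a, b} \<and> elts p = {s, t})"

definition is_bijection :: "'v \<Rightarrow> 'v \<Rightarrow> 'v \<Rightarrow> bool" where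
  "is_bijection f x y \<longleftrightarrow>
     (\<forall>p\<in>elts f. \<exists>a\<in>elts x. \<exists>b\<in>elts y. is_pair p a b) \<and>
     (\<forall>a\<in>elts x. \<exists>!b. b \<in> elts y \<and> (\<exists>p\<in>elts f. is_pair p a b)) \<and>
     (\<forall>b\<in>elts y. \<exists>!a. a \<in> elts x \<and> (\<exists>p\<in>elts f. is_pair p a b))"

text \<open>Well-foundedness of membership on an ordinal comes from Foundation.\<close>

definition ordinal :: "'v \<Rightarrow> bool" where
  "ordinal \<alpha> \<longleftrightarrow>
     (\<forall>\<beta>\<in>elts \<alpha>. elts \<beta> \<subseteq> elts \<alpha>) \<and>
     (\<forall>\<beta>\<in>elts \<alpha>. \<forall>\<gamma>\<in>elts \<alpha>. mem \<beta> \<gamma> \<or> \<beta> = \<gamma> \<or> mem \<gamma> \<beta>)"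

definition cardinal :: "'v \<Rightarrow> bool" where
  "cardinal \<mu> \<longleftrightarrow> ordinal \<mu> \<and> (\<forall>\<alpha>\<in>elts \<mu>. \<not> (\<exists>f. is_bijection f \<alpha> \<mu>))"

definition has_cardinality :: "'v \<Rightarrow> 'v \<Rightarrow> bool" where
  "has_cardinality x \<mu> \<longleftrightarrow> cardinal \<mu> \<and> (\<exists>f. is_bijection f x \<mu>)"

definition card_less :: "'v \<Rightarrow> 'v \<Rightarrow> bool" where
  "card_less x \<kappa> \<longleftrightarrow> (\<exists>\<mu>. has_cardinality x \<mu> \<and> mem \<mu> \<kappa>)"

definition ultrafilter :: "'v \<Rightarrow> 'v \<Rightarrow> bool" where
  "ultrafilter U X \<longleftrightarrow>
     (\<forall>A\<in>elts U. elts A \<subseteq> elts X) \<and>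
     X \<in> elts U \<and>
     (\<forall>A\<in>elts U. elts A \<noteq> {}) \<and>
     (\<forall>A\<in>elts U. \<forall>B. elts A \<subseteq> elts B \<and> elts B \<subseteq> elts X \<longrightarrow> B \<in> elts U) \<and>
     (\<forall>A\<in>elts U. \<forall>B\<in>elts U. belongs (elts A \<inter> elts B) (elts U)) \<and>
     (\<forall>A. elts A \<subseteq> elts X \<longrightarrow> A \<in> elts U \<or> belongs (elts X - elts A) (elts U))"

definition complete_ultrafilter :: "'v \<Rightarrow> 'v \<Rightarrow> 'v \<Rightarrow> bool" where
  "complete_ultrafilter \<kappa> U X \<longleftrightarrow>
     ultrafilter U X \<and>
     (\<forall>S. elts S \<subseteq> elts U \<and> elts S \<noteq> {} \<and> card_less S \<kappa> \<longrightarrow>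
        belongs (\<Inter>A\<in>elts S. elts A) (elts U))"

definition P_small :: "'v \<Rightarrow> 'v \<Rightarrow> 'v set" where
  "P_small \<kappa> x = {\<sigma>. elts \<sigma> \<subseteq> elts x \<and> card_less \<sigma> \<kappa>}"

definition fine :: "'v \<Rightarrow> 'v \<Rightarrow> 'v \<Rightarrow> bool" where
  "fine \<kappa> U x \<longleftrightarrow> (\<forall>\<alpha>\<in>elts x. belongs {\<sigma> \<in> P_small \<kappa> x. \<alpha> \<in> elts \<sigma>} (elts U))"

text \<open>
  No uncountability clause: \<open>\<kappa>\<close> is automatically infinite, and \<open>\<kappa> = \<omega>\<close> is admitted.
\<close>

definition strongly_compact :: "'v \<Rightarrow> bool" where
  "strongly_compact \<kappa> \<longleftrightarrow>
     cardinal \<kappa> \<and>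
     (\<forall>\<mu>. cardinal \<mu> \<and> (\<kappa> = \<mu> \<or> mem \<kappa> \<mu>) \<longrightarrow>
        (\<exists>P U. elts P = P_small \<kappa> \<mu> \<and> complete_ultrafilter \<kappa> U P \<and> fine \<kappa> U \<mu>))"

definition cover_property :: "'v \<Rightarrow> 'v set \<Rightarrow> bool" where
  "cover_property \<kappa> N \<longleftrightarrow>
     (\<forall>\<sigma>. elts \<sigma> \<subseteq> N \<and> card_less \<sigma> \<kappa> \<longrightarrow>
        (\<exists>\<tau>\<in>N. card_less \<tau> \<kappa> \<and> elts \<sigma> \<subseteq> elts \<tau>))"

definition approximation_property :: "'v \<Rightarrow> 'v set \<Rightarrow> bool" where
  "approximation_property \<kappa> N \<longleftrightarrow>
     (\<forall>A. elts A \<subseteq> N \<and> (\<forall>\<sigma>\<in>N. card_less \<sigma> \<kappa> \<longrightarrow> belongs (elts A \<inter> elts \<sigma>) N) \<longrightarrow>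
        A \<in> N)"

end

end

theory Submission
  imports Defs
begin

text \<open>
  If \<open>M\<close> has the approximation property, \<open>U\<close> is a \<open>\<kappa>\<close>-complete ultrafilter over \<open>X\<close> and \<open>\<sigma> \<in> M\<close> is
  small, then completeness gives a point \<open>x\<close> with \<open>B \<in> U \<longleftrightarrow> x \<in> B\<close> for all subsets \<open>B \<in> \<sigma>\<close> of \<open>X\<close>, so
  \<open>U \<inter> \<sigma>\<close> is definable in \<open>M\<close> from \<open>x\<close>.

  Conversely, let all \<open>A \<inter> \<sigma>\<close> with \<open>\<sigma> \<in> M\<close> small be in \<open>M\<close>, and let \<open>A \<subseteq> X \<in> M\<close>.  If \<open>A\<close> is small, the cover
  property suffices.  Otherwise let \<open>\<mu> = |A|\<close> and let \<open>g\<close> map \<open>\<mu>\<close> onto \<open>A\<close>.  Choose for each \<open>\<sigma> \<in> P\<^sub>\<kappa>(\<mu>)\<close> a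
  small \<open>\<tau> \<in> M\<close> covering \<open>g[\<sigma>]\<close>, put \<open>h(\<sigma>) = A \<inter> \<tau>\<close>, and push a fine ultrafilter on \<open>P\<^sub>\<kappa>(\<mu>)\<close> forward
  along \<open>h\<close> to an ultrafilter \<open>D\<close> over the power set of \<open>X\<close> in \<open>M\<close>.  By fineness \<open>x \<in> A\<close> iff
  \<open>{b. x \<in> b} \<in> D\<close>, and \<open>D \<inter> M \<in> M\<close>.
\<close>

section \<open>Definability\<close>

text \<open>The axiom schemas range over formulas, so a HOL set or function has to be shown
  definable before Separation or Replacement can be applied to it; the rules collected in
  \<open>dfn\<close> do this by following the syntax of the term. Two notions of definability are
  kept apart: over V with a predicate for M, which lets V collect objects defined from M, and over M
  without that predicate, which decides what lands in M. Smallness always refers to V, so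
  cardinalities are developed only there. Finding X in M with A \<subseteq> X takes most work inside
  M: A is only known to be a set of V, and bounding it needs the cumulative hierarchy of M. That
  hierarchy is given by one explicit formula, so that it can be used in both languages. The
  ultrafilter is moved to the power set of X in M because (2) speaks only of ultrafilters over
  members of M, and P_\<kappa>(\<mu>) need not be one.\<close>

primrec ren :: "(nat \<Rightarrow> nat) \<Rightarrow> fm \<Rightarrow> fm" where
  "ren f (Mem i j) = Mem (f i) (f j)"
| "ren f (Eq i j) = Eq (f i) (f j)"
| "ren f (Cls i) = Cls (f i)"
| "ren f (Neg \<phi>) = Neg (ren f \<phi>)"
| "ren f (Conj \<phi> \<psi>) = Conj (ren f \<phi>) (ren f \<psi>)"
| "ren f (All \<phi>) = All (ren (case_nat 0 (\<lambda>n. Suc (f n))) \<phi>)"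

lemma sat_ren: "sat D mem C (ren f \<phi>) e \<longleftrightarrow> sat D mem C \<phi> (\<lambda>n. e (f n))"
proof (induction \<phi> arbitrary: f e)
  case (All \<phi>)
  have "(\<lambda>n. case_nat a e (case_nat 0 (\<lambda>n. Suc (f n)) n)) = case_nat a (\<lambda>n. e (f n))" for a
    by (auto simp: fun_eq_iff split: nat.split)
  then show ?case by (simp add: All.IH)
qed auto

lemma odd_pred_div_two: "odd (n::nat) \<Longrightarrow> (n - Suc 0) div 2 = n div 2"
  by (auto elim!: oddE)

text \<open>Interleaving leaves infinitely many slots for variables and for parameters, so neither
  the free variables of a formula nor its parameters have to be counted.\<close>

definition merge :: "(nat \<Rightarrow> 'v) \<Rightarrow> (nat \<Rightarrow> 'v) \<Rightarrow> nat \<Rightarrow> 'v" where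
  "merge e p n = (if even n then e (n div 2) else p (n div 2))"

text \<open>The variables of \<open>\<phi>\<close> are split: the even ones are read from \<open>e\<close>, the odd ones hold parameters.\<close>

definition definable :: "'v set \<Rightarrow> ('v \<Rightarrow> 'v \<Rightarrow> bool) \<Rightarrow> 'v set \<Rightarrow> ((nat \<Rightarrow> 'v) \<Rightarrow> bool) \<Rightarrow> bool" where
  "definable D mem C P \<longleftrightarrow>
     (\<exists>\<phi> p. range p \<subseteq> D \<and> (\<forall>e. range e \<subseteq> D \<longrightarrow> P e = sat D mem C \<phi> (merge e p)))"

lemma definableI:
  assumes "range p \<subseteq> D" and "\<And>e. range e \<subseteq> D \<Longrightarrow> P e = sat D mem C \<phi> (\<lambda>n. merge e p (f n))"
  shows "definable D mem C P"
  unfolding definable_def using assms by (intro exI[of _ "ren f \<phi>"] exI[of _ p]) (simp add: sat_ren)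

lemma definable_cong:
  assumes "\<And>e. range e \<subseteq> D \<Longrightarrow> P e = Q e" and "definable D mem C Q"
  shows "definable D mem C P"
  using assms unfolding definable_def by force

lemma definable_rename:
  assumes "definable D mem C P"
  shows "definable D mem C (\<lambda>e. P (\<lambda>n. e (f n)))"
proof -
  obtain \<phi> p where p: "range p \<subseteq> D"
    and P: "\<And>e. range e \<subseteq> D \<Longrightarrow> P e = sat D mem C \<phi> (merge e p)"
    using assms unfolding definable_def by blast
  have *: "merge (\<lambda>n. e (f n)) p = (\<lambda>n. merge e p (if even n then 2 * f (n div 2) else n))" for e
    by (auto simp: merge_def fun_eq_iff)
  show ?thesis
  proof (rule definableI[OF p])
    fix e :: "nat \<Rightarrow> 'a" assume "range e \<subseteq> D"
    then have "range (\<lambda>n. e (f n)) \<subseteq> D" by auto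
    from P[OF this] show "P (\<lambda>n. e (f n)) =
        sat D mem C \<phi> (\<lambda>n. merge e p (if even n then 2 * f (n div 2) else n))"
      by (simp add: *)
  qed
qed

lemma definable_Neg:
  assumes "definable D mem C P"
  shows "definable D mem C (\<lambda>e. \<not> P e)"
proof -
  obtain \<phi> p where "range p \<subseteq> D" "\<And>e. range e \<subseteq> D \<Longrightarrow> P e = sat D mem C \<phi> (merge e p)"
    using assms unfolding definable_def by blast
  then show ?thesis
    unfolding definable_def by (intro exI[of _ "Neg \<phi>"] exI[of _ p]) simp
qed

lemma definable_Conj:
  assumes "definable D mem C P" and "definable D mem C Q"
  shows "definable D mem C (\<lambda>e. P e \<and> Q e)"
proof -
  obtain \<phi> p where p: "range p \<subseteq> D"
    and P: "\<And>e. range e \<subseteq> D \<Longrightarrow> P e = sat D mem C \<phi> (merge e p)"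
    using assms(1) unfolding definable_def by blast
  obtain \<psi> q where q: "range q \<subseteq> D"
    and Q: "\<And>e. range e \<subseteq> D \<Longrightarrow> Q e = sat D mem C \<psi> (merge e q)"
    using assms(2) unfolding definable_def by blast
  \<comment> \<open>Both formulas bring their own parameters, which are interleaved once more:
    \<open>p k\<close> becomes parameter number 2k and \<open>q k\<close> parameter number 2k + 1.
    \<open>f\<close> and \<open>g\<close> redirect the odd indices accordingly.\<close>
  define f where "f n = (if even n then n else Suc (2 * (2 * (n div 2))))" for n :: nat
  define g where "g n = (if even n then n else Suc (2 * Suc (2 * (n div 2))))" for n :: nat
  have f: "(\<lambda>n. merge e (merge p q) (f n)) = merge e p"
    and g: "(\<lambda>n. merge e (merge p q) (g n)) = merge e q" for e
    by (auto simp: merge_def f_def g_def fun_eq_iff odd_pred_div_two)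
  have "range (merge p q) \<subseteq> D"
    using p q by (auto simp: merge_def)
  then show ?thesis
    unfolding definable_def
    by (intro exI[of _ "Conj (ren f \<phi>) (ren g \<psi>)"] exI[of _ "merge p q"])
      (simp add: sat_ren f g P Q)
qed

lemma definable_Ball:
  assumes "definable D mem C (\<lambda>e. P (e 0) (\<lambda>n. e (Suc n)))"
  shows "definable D mem C (\<lambda>e. \<forall>x\<in>D. P x e)"
proof -
  obtain \<phi> p where p: "range p \<subseteq> D"
    and P: "\<And>e. range e \<subseteq> D \<Longrightarrow> P (e 0) (\<lambda>n. e (Suc n)) = sat D mem C \<phi> (merge e p)"
    using assms unfolding definable_def by blast
  \<comment> \<open>The quantifier prepends one slot to the merged environment, whereas prepending
    \<open>a\<close> to \<open>e\<close> before merging shifts the even slots by two. So positive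
    even indices drop by one and odd ones rise by one.\<close>
  define f where "f n = (if n = 0 then 0 else if even n then n - 1 else Suc n)" for n :: nat
  have f: "(\<lambda>n. case_nat a (merge e p) (f n)) = merge (case_nat a e) p" for a e
    by (rule ext, rename_tac n, case_tac n) (auto simp: f_def merge_def elim!: oddE evenE)
  have "range (case_nat a e) \<subseteq> D" if "a \<in> D" "range e \<subseteq> D" for a and e :: "nat \<Rightarrow> 'a"
    using that by (force split: nat.splits)
  from P[OF this] have "P a e = sat D mem C \<phi> (merge (case_nat a e) p)"
    if "a \<in> D" "range e \<subseteq> D" for a e using that by simp
  with p show ?thesis
    unfolding definable_def
    by (intro exI[of _ "All (ren f \<phi>)"] exI[of _ p]) (simp add: sat_ren f)
qed

lemma definable_Disj:
  "definable D mem C P \<Longrightarrow> definable D mem C Q \<Longrightarrow> definable D mem C (\<lambda>e. P e \<or> Q e)"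
  using definable_Neg[OF definable_Conj[OF definable_Neg definable_Neg], of D mem C P Q] by simp

lemma definable_Imp:
  "definable D mem C P \<Longrightarrow> definable D mem C Q \<Longrightarrow> definable D mem C (\<lambda>e. P e \<longrightarrow> Q e)"
  unfolding imp_conv_disj by (intro definable_Disj definable_Neg)

lemma definable_Iff:
  assumes "definable D mem C P" and "definable D mem C Q"
  shows "definable D mem C (\<lambda>e. P e \<longleftrightarrow> Q e)"
  unfolding iff_conv_conj_imp by (intro definable_Conj definable_Imp assms)

lemma definable_Bex:
  assumes "definable D mem C (\<lambda>e. P (e 0) (\<lambda>n. e (Suc n)))"
  shows "definable D mem C (\<lambda>e. \<exists>x\<in>D. P x e)"
proof -
  have "definable D mem C (\<lambda>e. \<not> (\<forall>x\<in>D. \<not> P x e))"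
    by (rule definable_Neg, rule definable_Ball, rule definable_Neg, rule assms)
  then show ?thesis by simp
qed

text \<open>Even \<open>i\<close> gives a variable and odd \<open>i\<close> a parameter, so the
  atoms need no case distinction between the two.\<close>

definition atomic_term :: "'v set \<Rightarrow> ((nat \<Rightarrow> 'v) \<Rightarrow> 'v) \<Rightarrow> bool" where
  "atomic_term D t \<longleftrightarrow> (\<exists>i p. range p \<subseteq> D \<and> t = (\<lambda>e. merge e p i))"

lemma atomic_var:
  assumes "D \<noteq> {}"
  shows "atomic_term D (\<lambda>e. e i)"
proof -
  obtain d where "d \<in> D" using assms by blast
  then show ?thesis
    unfolding atomic_term_def
    by (intro exI[of _ "2 * i"] exI[of _ "\<lambda>_. d"]) (simp add: merge_def)
qed

lemma atomic_const: "c \<in> D \<Longrightarrow> atomic_term D (\<lambda>e. c)"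
  unfolding atomic_term_def
  by (intro exI[of _ 1] exI[of _ "\<lambda>_. c"]) (simp add: merge_def)

lemma definable_atoms:
  assumes "atomic_term D t" and "atomic_term D u"
  shows definable_Mem: "definable D mem C (\<lambda>e. mem (t e) (u e))"
    and definable_Eq: "definable D mem C (\<lambda>e. t e = u e)"
proof -
  obtain p q i j where *: "range p \<subseteq> D" "range q \<subseteq> D"
    and t: "t = (\<lambda>e. merge e p i)" and u: "u = (\<lambda>e. merge e q j)"
    using assms unfolding atomic_term_def by blast
  define i' where "i' = (if even i then i else Suc (2 * (2 * (i div 2))))"
  define j' where "j' = (if even j then j else Suc (2 * Suc (2 * (j div 2))))"
  have i': "merge e (merge p q) i' = merge e p i" for e
    by (cases "even i") (simp_all add: i'_def merge_def odd_pred_div_two)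
  have j': "merge e (merge p q) j' = merge e q j" for e
    by (cases "even j") (simp_all add: j'_def merge_def odd_pred_div_two)
  have r: "range (merge p q) \<subseteq> D"
    using * by (auto simp: merge_def)
  show "definable D mem C (\<lambda>e. mem (t e) (u e))"
    unfolding definable_def t u
    by (intro exI[of _ "Mem i' j'"] exI[of _ "merge p q"]) (simp only: i' j' r sat.simps simp_thms)
  show "definable D mem C (\<lambda>e. t e = u e)"
    unfolding definable_def t u
    by (intro exI[of _ "Eq i' j'"] exI[of _ "merge p q"]) (simp only: i' j' r sat.simps simp_thms)
qed

lemma definable_Cls:
  assumes "atomic_term D t"
  shows "definable D mem C (\<lambda>e. t e \<in> C)"
proof -
  obtain p i where *: "range p \<subseteq> D" and t: "t = (\<lambda>e. merge e p i)"
    using assms unfolding atomic_term_def by blast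
  show ?thesis
    unfolding definable_def t using * by (intro exI[of _ "Cls i"] exI[of _ p]) simp
qed

section \<open>Separation and Replacement for definable predicates\<close>

lemma ZFC_separation:
  assumes "ZFC D mem C" and "definable D mem C (\<lambda>e. P (e 0))" and "x \<in> D"
  obtains y where "y \<in> D" "\<And>z. z \<in> D \<Longrightarrow> mem z y \<longleftrightarrow> mem z x \<and> P z"
proof -
  obtain \<phi> p where p: "range p \<subseteq> D"
    and P: "\<And>e. range e \<subseteq> D \<Longrightarrow> P (e 0) = sat D mem C \<phi> (merge e p)"
    using assms(2) unfolding definable_def by blast
  \<comment> \<open>The predicate looks at \<open>e 0\<close> only, so every variable slot may hold
    \<open>z\<close> and all even indices can be sent to the one slot of \<open>z\<close>.\<close>
  define f where "f n = (if even n then 0 else Suc (n div 2))" for n :: nat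
  have f: "(\<lambda>n. case_nat z p (f n)) = merge (\<lambda>_. z) p" for z
    by (auto simp: f_def merge_def fun_eq_iff)
  have "P z = sat D mem C (ren f \<phi>) (case_nat z p)" if "z \<in> D" for z
    using P[of "\<lambda>_. z"] that by (auto simp: sat_ren f)
  moreover have "\<exists>y\<in>D. \<forall>z\<in>D. mem z y \<longleftrightarrow> mem z x \<and> sat D mem C (ren f \<phi>) (case_nat z p)"
    by (rule assms(1)[unfolded ZFC_def, THEN conjunct2, THEN conjunct2, THEN conjunct2,
      THEN conjunct2, THEN conjunct2, THEN conjunct2, THEN conjunct1,
      THEN spec, THEN spec, THEN mp, OF p, THEN bspec, OF assms(3)])
  ultimately obtain y where "y \<in> D" "\<And>z. z \<in> D \<Longrightarrow> mem z y \<longleftrightarrow> mem z x \<and> P z" by auto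
  then show ?thesis using that by blast
qed

lemma ZFC_replacement:
  assumes "ZFC D mem C" and "definable D mem C (\<lambda>e. R (e 0) (e 1))" and "x \<in> D"
    and "\<And>u. u \<in> D \<Longrightarrow> mem u x \<Longrightarrow> \<exists>!v. v \<in> D \<and> R u v"
  obtains y where "y \<in> D" "\<And>v. v \<in> D \<Longrightarrow> mem v y \<longleftrightarrow> (\<exists>u\<in>D. mem u x \<and> R u v)"
proof -
  obtain \<phi> p where p: "range p \<subseteq> D"
    and P: "\<And>e. range e \<subseteq> D \<Longrightarrow> R (e 0) (e 1) = sat D mem C \<phi> (merge e p)"
    using assms(2) unfolding definable_def by blast
  \<comment> \<open>The same device with two variables: index 0 reads \<open>u\<close>, every other
    even index reads \<open>v\<close>.\<close>
  define f where "f n = (if n = 0 then 0 else if even n then 1 else Suc (Suc (n div 2)))" for n :: nat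
  have f: "(\<lambda>n. case_nat u (case_nat v p) (f n)) = merge (case_nat u (\<lambda>_. v)) p" for u v
    by (auto simp: f_def merge_def fun_eq_iff elim!: evenE split: nat.split)
  have R: "R u v = sat D mem C (ren f \<phi>) (case_nat u (case_nat v p))" if "u \<in> D" "v \<in> D" for u v
  proof -
    have "range (case_nat u (\<lambda>_. v)) \<subseteq> D" using that by (auto split: nat.splits)
    from P[OF this] show ?thesis by (simp add: sat_ren f)
  qed
  have "\<forall>u\<in>D. mem u x \<longrightarrow> (\<exists>!v. v \<in> D \<and> sat D mem C (ren f \<phi>) (case_nat u (case_nat v p)))"
  proof (intro ballI impI)
    fix u assume u: "u \<in> D" "mem u x"
    have "(v \<in> D \<and> sat D mem C (ren f \<phi>) (case_nat u (case_nat v p))) = (v \<in> D \<and> R u v)" for v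
      using R[OF u(1)] by blast
    then show "\<exists>!v. v \<in> D \<and> sat D mem C (ren f \<phi>) (case_nat u (case_nat v p))"
      using assms(4)[OF u] by simp
  qed
  from assms(1)[unfolded ZFC_def, THEN conjunct2, THEN conjunct2, THEN conjunct2,
      THEN conjunct2, THEN conjunct2, THEN conjunct2, THEN conjunct2, THEN conjunct1,
      THEN spec, THEN spec, THEN mp, OF p, THEN bspec, OF assms(3), THEN mp, OF this]
  obtain y where "y \<in> D" "\<forall>v\<in>D. mem v y \<longleftrightarrow>
      (\<exists>u\<in>D. mem u x \<and> sat D mem C (ren f \<phi>) (case_nat u (case_nat v p)))" by blast
  moreover from this have "mem v y \<longleftrightarrow> (\<exists>u\<in>D. mem u x \<and> R u v)" if "v \<in> D" for v
    using R that by auto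
  ultimately show ?thesis using that by blast
qed

section \<open>The universe\<close>

named_theorems dfn

text \<open>\<open>C\<close> stays open here and becomes M later, so that Separation and Replacement
  in V apply to properties that mention M.\<close>

locale universe = membership mem for mem :: "'v \<Rightarrow> 'v \<Rightarrow> bool" +
  fixes C :: "'v set"
  assumes zfc: "ZFC UNIV mem C"
begin

abbreviation dfn_pred :: "((nat \<Rightarrow> 'v) \<Rightarrow> bool) \<Rightarrow> bool" where
  "dfn_pred \<equiv> definable UNIV mem C"

text \<open>Class functions, given as HOL functions of the environment with definable graph. The
  value occupies index 0, hence the shift in the argument.\<close>

definition dfn_term :: "((nat \<Rightarrow> 'v) \<Rightarrow> 'v) \<Rightarrow> bool" where
  "dfn_term t \<longleftrightarrow> dfn_pred (\<lambda>e. e 0 = t (\<lambda>n. e (Suc n)))"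

lemmas [dfn] = definable_Neg definable_Conj definable_Disj definable_Imp definable_Iff

lemma dfn_All [dfn]: "dfn_pred (\<lambda>e. P (e 0) (\<lambda>n. e (Suc n))) \<Longrightarrow> dfn_pred (\<lambda>e. \<forall>x. P x e)"
  using definable_Ball[of UNIV mem C P] by simp

lemma dfn_Ex [dfn]: "dfn_pred (\<lambda>e. P (e 0) (\<lambda>n. e (Suc n))) \<Longrightarrow> dfn_pred (\<lambda>e. \<exists>x. P x e)"
  using definable_Bex[of UNIV mem C P] by simp

lemma dfn_term_var [dfn]: "dfn_term (\<lambda>e. e i)"
  unfolding dfn_term_def by (intro definable_Eq atomic_var) auto

lemma dfn_term_const [dfn]: "dfn_term (\<lambda>e. c)"
  unfolding dfn_term_def by (intro definable_Eq atomic_var atomic_const) auto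

lemma dfn_term_shift: "dfn_term t \<Longrightarrow> dfn_term (\<lambda>e. t (\<lambda>n. e (Suc n)))"
  unfolding dfn_term_def
  using definable_rename[of UNIV mem C "\<lambda>e. e 0 = t (\<lambda>n. e (Suc n))" "case_nat 0 (\<lambda>n. Suc (Suc n))"]
  by simp

text \<open>The language has no function symbols, so a term inside a predicate is eliminated by
  quantifying over its value. The substitution rules below all rest on this.\<close>

lemma dfn_let:
  assumes "dfn_term t" and "dfn_pred (\<lambda>e. P (e 0) (\<lambda>n. e (Suc n)))"
  shows "dfn_pred (\<lambda>e. P (t e) e)"
proof -
  have "dfn_pred (\<lambda>e. \<exists>x. x = t e \<and> P x e)"
    using assms unfolding dfn_term_def by (intro dfn_Ex definable_Conj)
  then show ?thesis by simp
qed

lemma dfn_subst1: "dfn_pred (\<lambda>e. P (e 0)) \<Longrightarrow> dfn_term t \<Longrightarrow> dfn_pred (\<lambda>e. P (t e))"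
  by (rule dfn_let[where P = "\<lambda>x e. P x"])

lemma dfn_subst2:
  assumes "dfn_pred (\<lambda>e. P (e 0) (e 1))" and t: "dfn_term t" and u: "dfn_term u"
  shows "dfn_pred (\<lambda>e. P (t e) (u e))"
proof (rule dfn_let[OF t], rule dfn_let[OF dfn_term_shift[OF u]])
  show "dfn_pred (\<lambda>e. P (e (Suc 0)) (e 0))"
    using definable_rename[OF assms(1), of "\<lambda>n. if n = 0 then Suc 0 else 0"] by simp
qed

lemma dfn_term_subst1:
  assumes "dfn_term (\<lambda>e. F (e 0))" and "dfn_term t"
  shows "dfn_term (\<lambda>e. F (t e))"
  unfolding dfn_term_def
proof (rule dfn_let[OF dfn_term_shift[OF assms(2)], where P = "\<lambda>y e. e 0 = F y"])
  show "dfn_pred (\<lambda>e. e (Suc 0) = F (e 0))"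
    \<comment> \<open>Truncated subtraction swaps indices 0 and 1: the graph has its value at 0 and
      its argument at 1, but here the newly bound argument sits at 0.\<close>
    using definable_rename[OF assms(1)[unfolded dfn_term_def], of "\<lambda>n. 1 - n"] by simp
qed

lemma dfn_term_subst2:
  assumes "dfn_term (\<lambda>e. F (e 0) (e 1))" and t: "dfn_term t" and u: "dfn_term u"
  shows "dfn_term (\<lambda>e. F (t e) (u e))"
  unfolding dfn_term_def
proof (rule dfn_let[OF dfn_term_shift[OF t], where P = "\<lambda>x e. e 0 = F x (u (\<lambda>n. e (Suc n)))"],
    rule dfn_let[OF dfn_term_shift[OF dfn_term_shift[OF u]], where P = "\<lambda>y e. e (Suc 0) = F (e 0) y"])
  show "dfn_pred (\<lambda>e. e (Suc (Suc 0)) = F (e (Suc 0)) (e 0))"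
    using definable_rename[OF assms(1)[unfolded dfn_term_def], of "\<lambda>n. 2 - n"]
    by (simp add: numeral_2_eq_2)
qed

lemma dfn_Eq [dfn]: "dfn_term t \<Longrightarrow> dfn_term u \<Longrightarrow> dfn_pred (\<lambda>e. t e = u e)"
  by (rule dfn_subst2) (auto intro!: definable_Eq atomic_var)

lemma dfn_elts [dfn]: "dfn_term t \<Longrightarrow> dfn_term u \<Longrightarrow> dfn_pred (\<lambda>e. t e \<in> elts (u e))"
  unfolding elts_def mem_Collect_eq
  by (rule dfn_subst2[where P = mem]) (auto intro!: definable_Mem atomic_var)

lemma dfn_Cls [dfn]: "dfn_term t \<Longrightarrow> dfn_pred (\<lambda>e. t e \<in> C)"
  by (rule dfn_subst1) (auto intro!: definable_Cls atomic_var)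

lemma dfn_Const [dfn]: "dfn_pred (\<lambda>e. b)"
proof (cases b)
  case True
  have "dfn_pred (\<lambda>e. e 0 = e 0)" by (intro dfn)
  with True show ?thesis by simp
next
  case False
  have "dfn_pred (\<lambda>e. \<not> e 0 = e 0)" by (intro dfn)
  with False show ?thesis by simp
qed

lemma dfn_Collect [dfn]: "dfn_pred (\<lambda>e. P (t e) e) \<Longrightarrow> dfn_pred (\<lambda>e. t e \<in> {z. P z e})"
  by simp

lemma dfn_BallS [dfn]:
  "dfn_pred (\<lambda>e. e 0 \<in> S (\<lambda>n. e (Suc n))) \<Longrightarrow> dfn_pred (\<lambda>e. P (e 0) (\<lambda>n. e (Suc n)))
    \<Longrightarrow> dfn_pred (\<lambda>e. \<forall>x\<in>S e. P x e)"
  unfolding Ball_def by (intro dfn)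

lemma dfn_BexS [dfn]:
  "dfn_pred (\<lambda>e. e 0 \<in> S (\<lambda>n. e (Suc n))) \<Longrightarrow> dfn_pred (\<lambda>e. P (e 0) (\<lambda>n. e (Suc n)))
    \<Longrightarrow> dfn_pred (\<lambda>e. \<exists>x\<in>S e. P x e)"
  unfolding Bex_def by (intro dfn)

lemma dfn_subset [dfn]:
  "dfn_pred (\<lambda>e. e 0 \<in> S (\<lambda>n. e (Suc n))) \<Longrightarrow> dfn_pred (\<lambda>e. e 0 \<in> T (\<lambda>n. e (Suc n)))
    \<Longrightarrow> dfn_pred (\<lambda>e. S e \<subseteq> T e)"
  unfolding subset_eq by (intro dfn)

lemma dfn_set_eq:
  "dfn_pred (\<lambda>e. e 0 \<in> S (\<lambda>n. e (Suc n))) \<Longrightarrow> dfn_pred (\<lambda>e. e 0 \<in> T (\<lambda>n. e (Suc n)))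
    \<Longrightarrow> dfn_pred (\<lambda>e. S e = T e)"
  unfolding set_eq_iff by (intro dfn)

lemma dfn_in_set_ops [dfn]:
  "dfn_pred (\<lambda>e. t e \<in> {})"
  "dfn_pred (\<lambda>e. t e \<in> S e) \<Longrightarrow> dfn_pred (\<lambda>e. t e \<in> T e) \<Longrightarrow> dfn_pred (\<lambda>e. t e \<in> S e \<union> T e)"
  "dfn_pred (\<lambda>e. t e \<in> S e) \<Longrightarrow> dfn_pred (\<lambda>e. t e \<in> T e) \<Longrightarrow> dfn_pred (\<lambda>e. t e \<in> S e \<inter> T e)"
  "dfn_pred (\<lambda>e. t e \<in> S e) \<Longrightarrow> dfn_pred (\<lambda>e. t e \<in> T e) \<Longrightarrow> dfn_pred (\<lambda>e. t e \<in> S e - T e)"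
  "dfn_pred (\<lambda>e. t e = u e) \<Longrightarrow> dfn_pred (\<lambda>e. t e \<in> T e) \<Longrightarrow> dfn_pred (\<lambda>e. t e \<in> insert (u e) (T e))"
  by (auto intro!: dfn)

lemma dfn_Ex1 [dfn]:
  assumes "dfn_pred (\<lambda>e. P (e 0) (\<lambda>n. e (Suc n)))"
  shows "dfn_pred (\<lambda>e. \<exists>!x. P x e)"
  unfolding Ex1_def
proof (intro dfn assms)
  show "dfn_pred (\<lambda>e. P (e 0) (\<lambda>n. e (Suc (Suc n))))"
    using definable_rename[OF assms, of "case_nat 0 (\<lambda>n. Suc (Suc n))"] by simp
qed

lemma dfn_term_If [dfn]:
  assumes P: "dfn_pred P" and t: "dfn_term t" and u: "dfn_term u"
  shows "dfn_term (\<lambda>e. if P e then t e else u e)"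
proof -
  have P': "dfn_pred (\<lambda>e. P (\<lambda>n. e (Suc n)))" by (rule definable_rename[OF P])
  have "dfn_pred (\<lambda>e. (P (\<lambda>n. e (Suc n)) \<longrightarrow> e 0 = t (\<lambda>n. e (Suc n))) \<and>
      (\<not> P (\<lambda>n. e (Suc n)) \<longrightarrow> e 0 = u (\<lambda>n. e (Suc n))))"
    by (intro definable_Conj definable_Imp definable_Neg P'
        t[unfolded dfn_term_def] u[unfolded dfn_term_def])
  then show ?thesis
    unfolding dfn_term_def by (rule definable_cong[rotated]) auto
qed

section \<open>Collections that are sets, and the axioms of ZFC in V\<close>

lemma elts_inject: "elts x = elts y \<longleftrightarrow> x = y"
proof
  assume "elts x = elts y"
  then have "\<forall>z. mem z x \<longleftrightarrow> mem z y" unfolding elts_def by blast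
  moreover have "\<forall>x y. (\<forall>z. mem z x \<longleftrightarrow> mem z y) \<longrightarrow> x = y"
    using zfc[unfolded ZFC_def, THEN conjunct1] by simp
  ultimately show "x = y" by blast
qed simp

definition isset :: "'v set \<Rightarrow> bool" where
  "isset S \<longleftrightarrow> (\<exists>x. elts x = S)"

definition vset :: "'v set \<Rightarrow> 'v" where
  "vset S = (THE x. elts x = S)"

lemma vset_elts [simp]: "vset (elts x) = x"
  unfolding vset_def by (simp add: elts_inject)

lemma isset_elts [simp]: "isset (elts x)"
  unfolding isset_def by blast

lemma elts_vset: "isset S \<Longrightarrow> elts (vset S) = S"
  unfolding isset_def by auto

lemma vset_inject: "isset S \<Longrightarrow> isset T \<Longrightarrow> vset S = vset T \<longleftrightarrow> S = T"
  by (metis elts_vset)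

text \<open>Holds whether or not \<open>S e\<close> is a set, so definability can be checked by
  syntax alone and set existence is proved separately.\<close>

lemma dfn_term_vset [dfn]:
  assumes "dfn_pred (\<lambda>e. e 0 \<in> S (\<lambda>n. e (Suc n)))"
  shows "dfn_term (\<lambda>e. vset (S e))"
proof -
  have 1: "dfn_pred (\<lambda>e. e 0 \<in> S (\<lambda>n. e (Suc (Suc n))))"
    using definable_rename[OF assms, of "case_nat 0 (\<lambda>n. Suc (Suc n))"] by simp
  have 2: "dfn_pred (\<lambda>e. e 0 \<in> S (\<lambda>n. e (Suc (Suc (Suc n)))))"
    using definable_rename[OF assms, of "case_nat 0 (\<lambda>n. Suc (Suc (Suc n)))"] by simp
  \<comment> \<open>For a proper class \<open>S\<close> the junk value \<open>vset S\<close> does not depend on \<open>S\<close>.\<close>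
  have *: "y = vset S \<longleftrightarrow> elts y = S \<or> (\<not> (\<exists>x. elts x = S) \<and> y = (THE x. False))" for y S
  proof (cases "\<exists>x. elts x = S")
    case False
    then have "(\<lambda>x. elts x = S) = (\<lambda>x. False)" by auto
    then have "vset S = (THE x. False)" unfolding vset_def by (rule arg_cong)
    with False show ?thesis by auto
  qed (auto simp: elts_inject)
  show ?thesis
    unfolding dfn_term_def * by (intro dfn dfn_set_eq 1 2)
qed

lemma foundation:
  assumes "x \<in> S" and "isset S"
  shows "\<exists>y\<in>S. \<forall>z\<in>S. z \<notin> elts y"
proof -
  have "\<forall>x. (\<exists>y. mem y x) \<longrightarrow> (\<exists>y. mem y x \<and> \<not> (\<exists>z. mem z x \<and> mem z y))"
    using zfc[unfolded ZFC_def, THEN conjunct2, THEN conjunct1] by simp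
  moreover obtain x' where x': "elts x' = S" using assms(2) unfolding isset_def by blast
  ultimately obtain y where "mem y x'" "\<not> (\<exists>z. mem z x' \<and> mem z y)"
    using assms(1) unfolding elts_def by blast
  with x' show ?thesis by (intro bexI[of _ y]) (auto simp: elts_def)
qed

lemma isset_pair: "isset {a, b}"
proof -
  have "\<forall>x y. \<exists>p. \<forall>z. mem z p \<longleftrightarrow> z = x \<or> z = y"
    using zfc[unfolded ZFC_def, THEN conjunct2, THEN conjunct2, THEN conjunct1] by simp
  then obtain p where "\<forall>z. mem z p \<longleftrightarrow> z = a \<or> z = b" by blast
  then show ?thesis unfolding isset_def elts_def by (intro exI[of _ p]) auto
qed

lemma isset_sing: "isset {a}"
  using isset_pair[of a a] by simp

lemma isset_Union: "isset (\<Union>y\<in>elts x. elts y)"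
proof -
  have "\<forall>x. \<exists>u. \<forall>z. mem z u \<longleftrightarrow> (\<exists>y. mem y x \<and> mem z y)"
    using zfc[unfolded ZFC_def, THEN conjunct2, THEN conjunct2, THEN conjunct2, THEN conjunct1] by simp
  then obtain u where "\<forall>z. mem z u \<longleftrightarrow> (\<exists>y. mem y x \<and> mem z y)" by blast
  then show ?thesis unfolding isset_def elts_def by (intro exI[of _ u]) auto
qed

lemma isset_Pow: "isset {y. elts y \<subseteq> elts x}"
proof -
  have "\<forall>x. \<exists>p. \<forall>z. mem z p \<longleftrightarrow> (\<forall>w. mem w z \<longrightarrow> mem w x)"
    using zfc[unfolded ZFC_def, THEN conjunct2, THEN conjunct2, THEN conjunct2, THEN conjunct2,
        THEN conjunct1] by simp
  then obtain p where "\<forall>z. mem z p \<longleftrightarrow> (\<forall>w. mem w z \<longrightarrow> mem w x)" by blast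
  then show ?thesis unfolding isset_def elts_def by (intro exI[of _ p]) auto
qed

lemma infinity:
  obtains w n where "n \<in> elts w" "elts n = {}"
    "\<And>x. x \<in> elts w \<Longrightarrow> \<exists>s\<in>elts w. elts s = insert x (elts x)"
proof -
  have "\<exists>w. (\<exists>n. mem n w \<and> (\<forall>z. \<not> mem z n)) \<and>
       (\<forall>x. mem x w \<longrightarrow> (\<exists>s. mem s w \<and> (\<forall>z. mem z s \<longleftrightarrow> mem z x \<or> z = x)))"
    using zfc[unfolded ZFC_def, THEN conjunct2, THEN conjunct2, THEN conjunct2, THEN conjunct2,
        THEN conjunct2, THEN conjunct1] by simp
  then obtain w n where *: "mem n w" "\<forall>z. \<not> mem z n"
    "\<forall>x. mem x w \<longrightarrow> (\<exists>s. mem s w \<and> (\<forall>z. mem z s \<longleftrightarrow> mem z x \<or> z = x))"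
    by blast
  show ?thesis
  proof (rule that)
    show "n \<in> elts w" "elts n = {}" using * by (auto simp: elts_def)
    fix x assume "x \<in> elts w"
    then obtain s where "mem s w" "\<forall>z. mem z s \<longleftrightarrow> mem z x \<or> z = x"
      using * by (auto simp: elts_def)
    then show "\<exists>s\<in>elts w. elts s = insert x (elts x)"
      unfolding elts_def by (intro bexI[of _ s]) auto
  qed
qed

lemma transversal:
  assumes "\<And>x. x \<in> elts F \<Longrightarrow> elts x \<noteq> {}"
    and "\<And>x y. x \<in> elts F \<Longrightarrow> y \<in> elts F \<Longrightarrow> x \<noteq> y \<Longrightarrow> elts x \<inter> elts y = {}"
  shows "\<exists>t. \<forall>x\<in>elts F. \<exists>!z. z \<in> elts x \<and> z \<in> elts t"
proof -
  have 1: "\<forall>x. mem x F \<longrightarrow> (\<exists>z. mem z x)"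
    using assms(1) unfolding elts_def by blast
  have 2: "\<forall>x y. mem x F \<and> mem y F \<and> x \<noteq> y \<longrightarrow> \<not> (\<exists>z. mem z x \<and> mem z y)"
    using assms(2) unfolding elts_def by blast
  have "(\<forall>x. mem x F \<longrightarrow> (\<exists>z. mem z x)) \<and>
      (\<forall>x y. mem x F \<and> mem y F \<and> x \<noteq> y \<longrightarrow> \<not> (\<exists>z. mem z x \<and> mem z y)) \<longrightarrow>
      (\<exists>t. \<forall>x. mem x F \<longrightarrow> (\<exists>!z. mem z x \<and> mem z t))"
    using zfc[unfolded ZFC_def, THEN conjunct2, THEN conjunct2, THEN conjunct2, THEN conjunct2,
        THEN conjunct2, THEN conjunct2, THEN conjunct2, THEN conjunct2, THEN bspec, OF UNIV_I, of F]
    by (simp only: ball_UNIV bex_UNIV UNIV_I simp_thms)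
  from this[THEN mp, OF conjI, OF 1 2]
  obtain t where t: "\<forall>x. mem x F \<longrightarrow> (\<exists>!z. mem z x \<and> mem z t)" by (rule exE)
  show ?thesis by (rule exI[of _ t]) (use t in \<open>simp add: elts_def\<close>)
qed

lemma isset_subset:
  assumes "dfn_pred (\<lambda>e. e 0 \<in> S)" and "S \<subseteq> elts x"
  shows "isset S"
proof -
  obtain y where "\<And>z. mem z y \<longleftrightarrow> mem z x \<and> z \<in> S"
    using ZFC_separation[OF zfc assms(1), of x] by (metis UNIV_I)
  then show ?thesis
    unfolding isset_def using assms(2) by (intro exI[of _ y]) (auto simp: elts_def)
qed

lemma isset_image:
  assumes "dfn_term (\<lambda>e. F (e 0))"
  shows "isset (F ` elts x)"
proof -
  have R: "dfn_pred (\<lambda>e. e 1 = F (e 0))"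
    by (intro dfn dfn_term_subst1[OF assms])
  obtain y where "\<And>v. mem v y \<longleftrightarrow> (\<exists>u. mem u x \<and> v = F u)"
    using ZFC_replacement[OF zfc R, of x] by auto
  then show ?thesis
    unfolding isset_def by (intro exI[of _ y]) (auto simp: elts_def)
qed

lemma isset_Int: "dfn_pred (\<lambda>e. e 0 \<in> S) \<Longrightarrow> isset (S \<inter> elts x)"
  by (rule isset_subset[of _ x]) (auto intro!: dfn)

lemma isset_empty [simp]: "isset {}"
  by (rule isset_subset) (auto intro!: dfn)

lemma isset_insert: "isset S \<Longrightarrow> isset (insert a S)"
proof -
  assume "isset S"
  then obtain x where x: "S = elts x" unfolding isset_def by blast
  have "elts (vset {a, a}) = {a}" "elts (vset {x, vset {a, a}}) = {x, vset {a, a}}"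
    by (simp_all add: elts_vset isset_pair isset_sing)
  then have "insert a S = (\<Union>y\<in>elts (vset {x, vset {a, a}}). elts y)"
    using x by auto
  with isset_Union[of "vset {x, vset {a, a}}"] show ?thesis by simp
qed

lemma isset_UN:
  assumes "dfn_term (\<lambda>e. F (e 0))"
  shows "isset (\<Union>y\<in>elts x. elts (F y))"
  using isset_Union[of "vset (F ` elts x)"] by (simp add: elts_vset isset_image[OF assms])

lemma isset_Un:
  assumes "isset S" and "isset T"
  shows "isset (S \<union> T)"
proof -
  obtain x y where xy: "elts x = S" "elts y = T" using assms unfolding isset_def by blast
  show ?thesis using isset_Union[of "vset {x, y}"] by (simp add: elts_vset isset_pair xy)
qed

definition pr :: "'v \<Rightarrow> 'v \<Rightarrow> 'v" where
  "pr a b = vset {vset {a}, vset {a, b}}"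

lemma dfn_pr [dfn]: "dfn_term t \<Longrightarrow> dfn_term u \<Longrightarrow> dfn_term (\<lambda>e. pr (t e) (u e))"
  by (rule dfn_term_subst2[where F = pr]) (simp_all only: pr_def, intro dfn)

lemma pr_inject [simp]: "pr a b = pr c d \<longleftrightarrow> a = c \<and> b = d"
  unfolding pr_def by (auto simp: vset_inject isset_pair isset_sing doubleton_eq_iff)

lemma is_pair_iff: "is_pair p a b \<longleftrightarrow> p = pr a b"
proof -
  have *: "elts s = S \<longleftrightarrow> s = vset S" if "isset S" for s S
    using elts_vset[OF that] by auto
  have "elts s = {a} \<longleftrightarrow> s = vset {a}" "elts t = {a, b} \<longleftrightarrow> t = vset {a, b}"
    "elts p = {s, t} \<longleftrightarrow> p = vset {s, t}" for s t
    by (simp_all only: * isset_pair isset_sing)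
  then show ?thesis unfolding is_pair_def pr_def by simp
qed

end

section \<open>Ordinals and recursion\<close>

context universe
begin

lemma mem_elts: "mem x y \<longleftrightarrow> x \<in> elts y"
  by (simp add: elts_def)

lemma elt_asym: "x \<in> elts y \<Longrightarrow> y \<notin> elts x"
  using foundation[of x "{x, y}", OF _ isset_pair] by blast

lemma elt_irrefl [simp]: "x \<notin> elts x"
  using elt_asym by blast

lemma elt_cycle3: "x \<in> elts y \<Longrightarrow> y \<in> elts z \<Longrightarrow> z \<notin> elts x"
  using foundation[of x "{x, y, z}", OF _ isset_insert[OF isset_pair]] by blast

section \<open>Basic theory of ordinals\<close>

lemma ordinal_iff:
  "ordinal \<alpha> \<longleftrightarrow> (\<forall>\<beta>\<in>elts \<alpha>. elts \<beta> \<subseteq> elts \<alpha>) \<and>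
     (\<forall>\<beta>\<in>elts \<alpha>. \<forall>\<gamma>\<in>elts \<alpha>. \<beta> \<in> elts \<gamma> \<or> \<beta> = \<gamma> \<or> \<gamma> \<in> elts \<beta>)"
  by (simp only: ordinal_def mem_elts)

lemma dfn_ordinal [dfn]: "dfn_term t \<Longrightarrow> dfn_pred (\<lambda>e. ordinal (t e))"
  by (rule dfn_subst1[where P = ordinal]) (simp_all only: ordinal_iff, intro dfn)

lemma ordinal_trans: "ordinal \<alpha> \<Longrightarrow> \<beta> \<in> elts \<alpha> \<Longrightarrow> \<gamma> \<in> elts \<beta> \<Longrightarrow> \<gamma> \<in> elts \<alpha>"
  unfolding ordinal_def by blast

lemma ordinal_cmp:
  assumes "ordinal \<alpha>" and "\<beta> \<in> elts \<alpha>" and "\<gamma> \<in> elts \<alpha>"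
  shows "\<beta> \<in> elts \<gamma> \<or> \<beta> = \<gamma> \<or> \<gamma> \<in> elts \<beta>"
  using assms unfolding ordinal_iff by simp

lemma ordinal_elt:
  assumes \<alpha>: "ordinal \<alpha>" and \<beta>: "\<beta> \<in> elts \<alpha>"
  shows "ordinal \<beta>"
  unfolding ordinal_iff
proof (intro conjI ballI subsetI)
  fix \<gamma> \<delta> assume \<gamma>: "\<gamma> \<in> elts \<beta>"
  then have \<gamma>': "\<gamma> \<in> elts \<alpha>" using ordinal_trans[OF \<alpha> \<beta>] by blast
  {
    assume \<delta>: "\<delta> \<in> elts \<gamma>"
    then have "\<delta> \<in> elts \<alpha>" using ordinal_trans[OF \<alpha> \<gamma>'] by blast
    \<comment> \<open>The other two positions of \<delta> relative to \<beta> would close a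
      membership cycle of length two or three.\<close>
    from ordinal_cmp[OF \<alpha> this \<beta>] show "\<delta> \<in> elts \<beta>"
    proof (elim disjE)
      assume "\<delta> = \<beta>"
      with \<delta> \<gamma> elt_asym[OF \<gamma>] show ?thesis by simp
    next
      assume "\<beta> \<in> elts \<delta>"
      with elt_cycle3[OF \<delta> \<gamma>] show ?thesis by simp
    qed
  next
    assume "\<delta> \<in> elts \<beta>"
    then have "\<delta> \<in> elts \<alpha>" using ordinal_trans[OF \<alpha> \<beta>] by blast
    then show "\<gamma> \<in> elts \<delta> \<or> \<gamma> = \<delta> \<or> \<delta> \<in> elts \<gamma>"
      by (rule ordinal_cmp[OF \<alpha> \<gamma>'])
  }
qed

text \<open>Foundation speaks of sets, so the class is cut down to its members below \<alpha>;
  transitivity of \<alpha> makes a minimal one minimal in all of \<open>S\<close>.\<close>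

lemma ordinal_least:
  assumes S: "dfn_pred (\<lambda>e. e 0 \<in> S)" and \<alpha>: "ordinal \<alpha>" "\<alpha> \<in> S"
  shows "\<exists>\<beta>. ordinal \<beta> \<and> \<beta> \<in> S \<and> (\<forall>\<gamma>\<in>S. \<gamma> \<notin> elts \<beta>)"
proof (cases "S \<inter> elts \<alpha> = {}")
  case True
  then show ?thesis using \<alpha> by blast
next
  case False
  then obtain \<beta>' where "\<beta>' \<in> S \<inter> elts \<alpha>" by blast
  then obtain \<beta> where \<beta>: "\<beta> \<in> S \<inter> elts \<alpha>" "\<forall>\<gamma>\<in>S \<inter> elts \<alpha>. \<gamma> \<notin> elts \<beta>"
    using foundation[OF _ isset_Int[OF S]] by blast
  show ?thesis
  proof (intro exI[of _ \<beta>] conjI ballI)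
    show "ordinal \<beta>" "\<beta> \<in> S" using \<beta>(1) ordinal_elt[OF \<alpha>(1)] by auto
    show "\<gamma> \<notin> elts \<beta>" if "\<gamma> \<in> S" for \<gamma>
      using \<beta> that ordinal_trans[OF \<alpha>(1)] by blast
  qed
qed

text \<open>If the inclusion is proper, a membership-minimal element of \<alpha> - \<beta> turns out
  to be \<beta> itself.\<close>

lemma ordinal_subset:
  assumes \<alpha>: "ordinal \<alpha>" and \<beta>: "ordinal \<beta>" and sub: "elts \<beta> \<subseteq> elts \<alpha>"
  shows "\<beta> = \<alpha> \<or> \<beta> \<in> elts \<alpha>"
proof (rule disjCI)
  assume "\<beta> \<notin> elts \<alpha>"
  show "\<beta> = \<alpha>"
  proof (rule ccontr)
    assume "\<beta> \<noteq> \<alpha>"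
    then obtain \<gamma>' where "\<gamma>' \<in> elts \<alpha> - elts \<beta>" using sub elts_inject by blast
    moreover have "isset (elts \<alpha> - elts \<beta>)"
      by (rule isset_subset[of _ \<alpha>]) (auto intro!: dfn)
    ultimately obtain \<gamma> where \<gamma>: "\<gamma> \<in> elts \<alpha> - elts \<beta>"
      "\<forall>\<delta>\<in>elts \<alpha> - elts \<beta>. \<delta> \<notin> elts \<gamma>"
      using foundation by blast
    have "elts \<gamma> \<subseteq> elts \<beta>" using \<gamma> ordinal_trans[OF \<alpha>] by blast
    moreover have "\<delta> \<in> elts \<gamma>" if \<delta>: "\<delta> \<in> elts \<beta>" for \<delta>
    proof -
      have "\<delta> \<in> elts \<gamma> \<or> \<delta> = \<gamma> \<or> \<gamma> \<in> elts \<delta>"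
        using ordinal_cmp[OF \<alpha>] \<delta> sub \<gamma>(1) by blast
      then show ?thesis using \<gamma>(1) \<delta> ordinal_trans[OF \<beta> \<delta>] by blast
    qed
    ultimately have "\<gamma> = \<beta>" using elts_inject by blast
    with \<gamma>(1) \<open>\<beta> \<notin> elts \<alpha>\<close> show False by blast
  qed
qed

lemma ordinal_vset_I:
  assumes "isset S" and "\<And>\<alpha>. \<alpha> \<in> S \<Longrightarrow> elts \<alpha> \<subseteq> S"
    and "\<And>\<alpha> \<beta>. \<alpha> \<in> S \<Longrightarrow> \<beta> \<in> S \<Longrightarrow> \<alpha> \<in> elts \<beta> \<or> \<alpha> = \<beta> \<or> \<beta> \<in> elts \<alpha>"
  shows "ordinal (vset S)"
  unfolding ordinal_iff elts_vset[OF assms(1)] using assms(2,3) by simp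

text \<open>The intersection is an ordinal. It cannot be a proper initial segment of both, since it
  would then be an element of itself.\<close>

lemma ordinal_linear:
  assumes \<alpha>: "ordinal \<alpha>" and \<beta>: "ordinal \<beta>"
  shows "\<alpha> \<in> elts \<beta> \<or> \<alpha> = \<beta> \<or> \<beta> \<in> elts \<alpha>"
proof -
  define \<gamma> where "\<gamma> = vset (elts \<alpha> \<inter> elts \<beta>)"
  have s: "isset (elts \<alpha> \<inter> elts \<beta>)" by (rule isset_Int) (intro dfn)
  have e: "elts \<gamma> = elts \<alpha> \<inter> elts \<beta>" unfolding \<gamma>_def using s by (rule elts_vset)
  have "ordinal \<gamma>"
    unfolding \<gamma>_def using s
  proof (rule ordinal_vset_I)
    show "elts x \<subseteq> elts \<alpha> \<inter> elts \<beta>" if "x \<in> elts \<alpha> \<inter> elts \<beta>" for x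
      using that ordinal_trans[OF \<alpha>] ordinal_trans[OF \<beta>] by blast
    show "x \<in> elts y \<or> x = y \<or> y \<in> elts x" if "x \<in> elts \<alpha> \<inter> elts \<beta>" "y \<in> elts \<alpha> \<inter> elts \<beta>" for x y
      using that ordinal_cmp[OF \<alpha>] by blast
  qed
  with \<alpha> \<beta> have "\<gamma> = \<alpha> \<or> \<gamma> \<in> elts \<alpha>" "\<gamma> = \<beta> \<or> \<gamma> \<in> elts \<beta>"
    using ordinal_subset e by auto
  moreover have "\<not> (\<gamma> \<in> elts \<alpha> \<and> \<gamma> \<in> elts \<beta>)"
    using e elt_irrefl[of \<gamma>] by blast
  ultimately show ?thesis by blast
qed

lemma ordinal_vset:
  assumes "isset S" and "\<And>\<alpha>. \<alpha> \<in> S \<Longrightarrow> ordinal \<alpha>" and "\<And>\<alpha>. \<alpha> \<in> S \<Longrightarrow> elts \<alpha> \<subseteq> S"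
  shows "ordinal (vset S)"
  using assms ordinal_linear by (intro ordinal_vset_I) blast+

lemma ordinal_succ:
  assumes \<alpha>: "ordinal \<alpha>" and s: "elts s = insert \<alpha> (elts \<alpha>)"
  shows "ordinal s"
proof -
  have "ordinal (vset (elts s))"
    using ordinal_elt[OF \<alpha>] ordinal_trans[OF \<alpha>] \<alpha> unfolding s
    by (intro ordinal_vset isset_insert isset_elts) auto
  then show ?thesis by simp
qed

text \<open>Burali-Forti: such a set would be an ordinal and hence its own element.\<close>

lemma ordinals_not_set: "\<not> isset {\<alpha>. ordinal \<alpha>}"
proof
  assume s: "isset {\<alpha>. ordinal \<alpha>}"
  then have "ordinal (vset {\<alpha>. ordinal \<alpha>})"
    by (rule ordinal_vset) (auto intro: ordinal_elt)
  then show False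
    using elts_vset[OF s] elt_irrefl by blast
qed

text \<open>Stands in for \<omega>: iteration along an ordinal only asks that it be nonempty and
  closed under successors.\<close>

lemma limit_ordinal:
  obtains l where "ordinal l" "elts l \<noteq> {}"
    "\<And>\<beta>. \<beta> \<in> elts l \<Longrightarrow> \<exists>s\<in>elts l. elts s = insert \<beta> (elts \<beta>)"
proof -
  obtain w n where w: "n \<in> elts w" "elts n = {}"
    "\<And>x. x \<in> elts w \<Longrightarrow> \<exists>s\<in>elts w. elts s = insert x (elts x)"
    by (rule infinity) blast
  have "isset ({\<alpha>. ordinal \<alpha>} \<inter> elts w)" by (rule isset_Int) (intro dfn)
  then obtain u where u: "elts u = {\<alpha>. ordinal \<alpha>} \<inter> elts w" unfolding isset_def by blast
  have succ: "\<exists>s\<in>elts u. elts s = insert \<alpha> (elts \<alpha>)" if \<alpha>: "\<alpha> \<in> elts u" for \<alpha>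
  proof -
    obtain s where s: "s \<in> elts w" "elts s = insert \<alpha> (elts \<alpha>)" using w(3) \<alpha> u by blast
    have "ordinal \<alpha>" using \<alpha> u by blast
    then have "ordinal s" using s(2) by (rule ordinal_succ)
    with s u show ?thesis by auto
  qed
  \<comment> \<open>The ordinals in \<open>w\<close> need not form a transitive set; their union
    does.\<close>
  define l where "l = vset (\<Union>y\<in>elts u. elts y)"
  have l: "elts l = (\<Union>y\<in>elts u. elts y)"
    unfolding l_def by (rule elts_vset[OF isset_Union])
  show ?thesis
  proof (rule that[of l])
    show "ordinal l"
      unfolding l_def using u
      by (intro ordinal_vset isset_Union) (auto intro: ordinal_elt ordinal_trans)
    have "ordinal n" using w(2) by (simp add: ordinal_def)
    with u w(1) have "n \<in> elts u" by blast
    from succ[OF this] show "elts l \<noteq> {}" using l by blast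
    fix \<beta> assume "\<beta> \<in> elts l"
    then obtain \<alpha> where \<alpha>: "\<alpha> \<in> elts u" "\<beta> \<in> elts \<alpha>" using l by blast
    then have o: "ordinal \<alpha>" "ordinal \<beta>" using u ordinal_elt by blast+
    obtain s where s: "elts s = insert \<beta> (elts \<beta>)"
      using isset_insert[OF isset_elts, of \<beta> \<beta>] unfolding isset_def by blast
    have "ordinal s" using o(2) s by (rule ordinal_succ)
    then have "s = \<alpha> \<or> s \<in> elts \<alpha>"
      by (rule ordinal_subset[OF o(1)]) (use s \<alpha>(2) ordinal_trans[OF o(1) \<alpha>(2)] in auto)
    moreover obtain t where "t \<in> elts u" "elts t = insert \<alpha> (elts \<alpha>)" using succ[OF \<alpha>(1)] by blast
    ultimately have "s \<in> elts l" unfolding l by blast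
    with s show "\<exists>s\<in>elts l. elts s = insert \<beta> (elts \<beta>)" by blast
  qed
qed

text \<open>\<open>f\<close> is, up to irrelevant elements, the graph on \<open>\<alpha>\<close> of the function defined by recursion with
  step \<open>G\<close>, where \<open>G\<close> receives the set of the values at smaller ordinals.\<close>

definition recursive_on :: "('v \<Rightarrow> 'v) \<Rightarrow> 'v \<Rightarrow> 'v \<Rightarrow> bool" where
  "recursive_on G f \<alpha> \<longleftrightarrow>
     (\<forall>\<beta>\<in>elts \<alpha>. \<forall>y. pr \<beta> y \<in> elts f \<longleftrightarrow> y = G (vset {z. \<exists>\<gamma>\<in>elts \<beta>. pr \<gamma> z \<in> elts f}))"

text \<open>\<open>H\<close> has to be a class function, so it is written down at once by a formula
  that quantifies over set approximations. Any two approximations agree, and a least ordinal without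
  one is impossible, because \<open>H\<close> restricted to it would be one.\<close>

lemma ordinal_recursion:
  assumes G: "dfn_term (\<lambda>e. G (e 0))"
  shows "\<exists>H. dfn_term (\<lambda>e. H (e 0)) \<and> (\<forall>\<alpha>. ordinal \<alpha> \<longrightarrow> H \<alpha> = G (vset (H ` elts \<alpha>)))"
proof -
  note [dfn] = dfn_term_subst1[OF G]
  have [dfn]: "dfn_pred (\<lambda>e. recursive_on G (t e) (u e))" if "dfn_term t" "dfn_term u" for t u
    using _ that by (rule dfn_subst2) (simp only: recursive_on_def, intro dfn)
  \<comment> \<open>Values are collected over all approximations, so none has to be chosen; by
    \<open>unique\<close> each of them contributes the same ones.\<close>
  define H where "H \<alpha> = G (vset {z. \<exists>f. recursive_on G f \<alpha> \<and> (\<exists>\<gamma>\<in>elts \<alpha>. pr \<gamma> z \<in> elts f)})" for \<alpha>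
  have H: "dfn_term (\<lambda>e. H (e 0))" unfolding H_def by (intro dfn)
  have down: "recursive_on G f \<beta>" if "recursive_on G f \<alpha>" "ordinal \<alpha>" "\<beta> \<in> elts \<alpha>" for f \<alpha> \<beta>
    using that ordinal_trans unfolding recursive_on_def by blast
  have unique: "pr \<beta> y \<in> elts f \<longleftrightarrow> pr \<beta> y \<in> elts g"
    if \<alpha>: "ordinal \<alpha>" and f: "recursive_on G f \<alpha>" and g: "recursive_on G g \<alpha>" and \<beta>: "\<beta> \<in> elts \<alpha>"
    for \<alpha> \<beta> y f g
  proof (rule ccontr)
    assume ne: "\<not> ?thesis"
    define S where "S = {\<beta>. \<beta> \<in> elts \<alpha> \<and> (\<exists>y. \<not> (pr \<beta> y \<in> elts f \<longleftrightarrow> pr \<beta> y \<in> elts g))}"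
    have "dfn_pred (\<lambda>e. e 0 \<in> S)" unfolding S_def by (intro dfn)
    moreover have "ordinal \<beta>" "\<beta> \<in> S" unfolding S_def using \<alpha> \<beta> ne ordinal_elt by blast+
    ultimately obtain \<gamma> where \<gamma>: "\<gamma> \<in> S" "\<And>\<delta>. \<delta> \<in> S \<Longrightarrow> \<delta> \<notin> elts \<gamma>"
      using ordinal_least by blast
    then have \<gamma>': "\<gamma> \<in> elts \<alpha>" unfolding S_def by blast
    have "{z. \<exists>\<delta>\<in>elts \<gamma>. pr \<delta> z \<in> elts f} = {z. \<exists>\<delta>\<in>elts \<gamma>. pr \<delta> z \<in> elts g}"
      using \<gamma>(2) ordinal_trans[OF \<alpha> \<gamma>'] unfolding S_def by blast
    with f g \<gamma>' have "pr \<gamma> y \<in> elts f \<longleftrightarrow> pr \<gamma> y \<in> elts g" for y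
      unfolding recursive_on_def by simp
    with \<gamma>(1) show False unfolding S_def by blast
  qed
  have val: "H \<alpha> = G (vset {z. \<exists>\<gamma>\<in>elts \<alpha>. pr \<gamma> z \<in> elts f})"
    if \<alpha>: "ordinal \<alpha>" and f: "recursive_on G f \<alpha>" for \<alpha> f
  proof -
    have "{z. \<exists>f. recursive_on G f \<alpha> \<and> (\<exists>\<gamma>\<in>elts \<alpha>. pr \<gamma> z \<in> elts f)} =
        {z. \<exists>\<gamma>\<in>elts \<alpha>. pr \<gamma> z \<in> elts f}"
      using unique[OF \<alpha>] f by blast
    then show ?thesis unfolding H_def by simp
  qed
  have graph: "pr \<beta> y \<in> elts f \<longleftrightarrow> y = H \<beta>"
    if \<alpha>: "ordinal \<alpha>" and f: "recursive_on G f \<alpha>" and \<beta>: "\<beta> \<in> elts \<alpha>" for \<alpha> \<beta> y f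
    using val[OF ordinal_elt[OF \<alpha> \<beta>] down[OF f \<alpha> \<beta>]] f \<beta> unfolding recursive_on_def by simp
  have image: "H \<alpha> = G (vset (H ` elts \<alpha>))"
    if \<alpha>: "ordinal \<alpha>" and f: "recursive_on G f \<alpha>" for \<alpha> f
  proof -
    have "{z. \<exists>\<gamma>\<in>elts \<alpha>. pr \<gamma> z \<in> elts f} = H ` elts \<alpha>"
      using graph[OF \<alpha> f] by blast
    then show ?thesis using val[OF \<alpha> f] by simp
  qed
  have ex: "\<exists>f. recursive_on G f \<alpha>" if \<alpha>: "ordinal \<alpha>" for \<alpha>
  proof (rule ccontr)
    assume no: "\<not> ?thesis"
    define S where "S = {\<alpha>. ordinal \<alpha> \<and> \<not> (\<exists>f. recursive_on G f \<alpha>)}"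
    have "dfn_pred (\<lambda>e. e 0 \<in> S)" unfolding S_def by (intro dfn)
    moreover have "\<alpha> \<in> S" unfolding S_def using \<alpha> no by blast
    ultimately obtain \<beta> where \<beta>: "ordinal \<beta>" "\<beta> \<in> S" "\<And>\<delta>. \<delta> \<in> S \<Longrightarrow> \<delta> \<notin> elts \<beta>"
      using \<alpha> ordinal_least by blast
    have step: "H \<gamma> = G (vset (H ` elts \<gamma>))" if \<gamma>: "\<gamma> \<in> elts \<beta>" for \<gamma>
    proof -
      have "ordinal \<gamma>" using \<beta>(1) \<gamma> by (rule ordinal_elt)
      moreover from this have "\<exists>f. recursive_on G f \<gamma>" using \<beta>(3)[of \<gamma>] \<gamma> unfolding S_def by blast
      ultimately show ?thesis using image by blast
    qed
    have "dfn_term (\<lambda>e. pr (e 0) (H (e 0)))" by (intro dfn H)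
    then have "isset ((\<lambda>\<gamma>. pr \<gamma> (H \<gamma>)) ` elts \<beta>)" by (rule isset_image)
    then obtain f where f: "elts f = (\<lambda>\<gamma>. pr \<gamma> (H \<gamma>)) ` elts \<beta>" unfolding isset_def by blast
    have "recursive_on G f \<beta>"
      unfolding recursive_on_def
    proof (intro ballI allI)
      fix \<gamma> y assume \<gamma>: "\<gamma> \<in> elts \<beta>"
      have "{z. \<exists>\<delta>\<in>elts \<gamma>. pr \<delta> z \<in> elts f} = H ` elts \<gamma>"
        unfolding f using ordinal_trans[OF \<beta>(1) \<gamma>] by auto
      moreover have "pr \<gamma> y \<in> elts f \<longleftrightarrow> y = H \<gamma>" unfolding f using \<gamma> by auto
      ultimately show "pr \<gamma> y \<in> elts f \<longleftrightarrow> y = G (vset {z. \<exists>\<delta>\<in>elts \<gamma>. pr \<delta> z \<in> elts f})"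
        using step[OF \<gamma>] by simp
    qed
    with \<beta>(2) show False unfolding S_def by blast
  qed
  show ?thesis
    using H image ex by blast
qed

text \<open>Iterates the union operation along a limit ordinal: each stage contains the elements of
  the elements of all earlier stages, so the union of the stages is transitive.\<close>

lemma transitive_superset:
  obtains t where "elts x \<subseteq> elts t" "\<And>y. y \<in> elts t \<Longrightarrow> elts y \<subseteq> elts t"
proof -
  define G where "G s = vset (elts x \<union> ({w. \<exists>y\<in>elts s. \<exists>z\<in>elts y. w \<in> elts z}))" for s
  have G: "dfn_term (\<lambda>e. G (e 0))" unfolding G_def by (intro dfn)
  have G_elts: "elts (G s) = elts x \<union> {w. \<exists>y\<in>elts s. \<exists>z\<in>elts y. w \<in> elts z}" for s
  proof -
    have "{w. \<exists>y\<in>elts s. \<exists>z\<in>elts y. w \<in> elts z} =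
        (\<Union>z\<in>elts (vset (\<Union>y\<in>elts s. elts y)). elts z)"
      by (auto simp: elts_vset isset_Union)
    then have "isset {w. \<exists>y\<in>elts s. \<exists>z\<in>elts y. w \<in> elts z}" using isset_Union by simp
    then show ?thesis unfolding G_def by (simp add: elts_vset isset_Un)
  qed
  obtain H where H: "dfn_term (\<lambda>e. H (e 0))" "\<And>\<alpha>. ordinal \<alpha> \<Longrightarrow> H \<alpha> = G (vset (H ` elts \<alpha>))"
    using ordinal_recursion[OF G] by blast
  have H_elts: "elts (H \<alpha>) = elts x \<union> {w. \<exists>\<beta>\<in>elts \<alpha>. \<exists>z\<in>elts (H \<beta>). w \<in> elts z}"
    if "ordinal \<alpha>" for \<alpha>
    unfolding H(2)[OF that] G_elts by (simp add: elts_vset isset_image[OF H(1)])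
  obtain l where l: "ordinal l" "elts l \<noteq> {}"
    "\<And>\<beta>. \<beta> \<in> elts l \<Longrightarrow> \<exists>s\<in>elts l. elts s = insert \<beta> (elts \<beta>)"
    by (rule limit_ordinal) blast
  obtain t where t: "elts t = (\<Union>\<alpha>\<in>elts l. elts (H \<alpha>))"
    using isset_UN[OF H(1), of l] unfolding isset_def by blast
  show ?thesis
  proof (rule that[of t])
    obtain \<alpha> where "\<alpha> \<in> elts l" using l(2) by blast
    then show "elts x \<subseteq> elts t" using t H_elts[OF ordinal_elt[OF l(1)]] by blast
    fix y assume "y \<in> elts t"
    then obtain \<alpha> where \<alpha>: "\<alpha> \<in> elts l" "y \<in> elts (H \<alpha>)" using t by blast
    then obtain s where s: "s \<in> elts l" "elts s = insert \<alpha> (elts \<alpha>)" using l(3) by blast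
    then have "elts y \<subseteq> elts (H s)"
      using \<alpha>(2) H_elts[OF ordinal_elt[OF l(1) s(1)]] by blast
    with t s(1) show "elts y \<subseteq> elts t" by blast
  qed
qed

text \<open>Foundation is applied to the part of \<open>S\<close> inside a transitive set around
  \<open>x\<close>; a minimal element of that part has all its own elements in the same set, hence
  is minimal in \<open>S\<close>.\<close>

lemma class_foundation:
  assumes S: "dfn_pred (\<lambda>e. e 0 \<in> S)" and "x \<in> S"
  obtains y where "y \<in> S" "\<And>z. z \<in> elts y \<Longrightarrow> z \<notin> S"
proof -
  obtain t where t: "elts (vset {x}) \<subseteq> elts t" "\<And>y. y \<in> elts t \<Longrightarrow> elts y \<subseteq> elts t"
    by (rule transitive_superset) blast
  then have "x \<in> S \<inter> elts t" using assms(2) by (simp add: elts_vset isset_sing)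
  then obtain y where y: "y \<in> S \<inter> elts t" "\<forall>z\<in>S \<inter> elts t. z \<notin> elts y"
    using foundation[OF _ isset_Int[OF S]] by blast
  show ?thesis
    by (rule that[of y]) (use y t(2) in blast)+
qed

end

section \<open>Cardinality\<close>

context universe
begin

lemma definable_function:
  assumes R: "dfn_pred (\<lambda>e. R (e 0) (e 1))"
  shows "\<exists>F. dfn_term (\<lambda>e. F (e 0)) \<and> (\<forall>a b. R a b \<and> (\<forall>b'. R a b' \<longrightarrow> b' = b) \<longrightarrow> F a = b)"
\<comment> \<open>The union of all values of \<open>R\<close> at \<open>a\<close>. It is definable
  everywhere and equals the value wherever there is exactly one.\<close>
proof (intro exI[of _ "\<lambda>a. vset {z. \<exists>b. R a b \<and> z \<in> elts b}"] conjI allI impI)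
  show "dfn_term (\<lambda>e. vset {z. \<exists>b. R (e 0) b \<and> z \<in> elts b})"
    by (intro dfn dfn_subst2[where P = R, OF R])
  fix a b assume "R a b \<and> (\<forall>b'. R a b' \<longrightarrow> b' = b)"
  then have "{z. \<exists>b. R a b \<and> z \<in> elts b} = elts b" by blast
  then show "vset {z. \<exists>b. R a b \<and> z \<in> elts b} = b" by simp
qed

lemma definable_inverse:
  assumes F: "dfn_term (\<lambda>e. F (e 0))" and S: "dfn_pred (\<lambda>e. e 0 \<in> S)" and inj: "inj_on F S"
  shows "\<exists>G. dfn_term (\<lambda>e. G (e 0)) \<and> (\<forall>a\<in>S. G (F a) = a)"
proof -
  have "dfn_pred (\<lambda>e. e 1 \<in> S \<and> F (e 1) = e 0)"
    by (intro dfn dfn_subst1[where P = "\<lambda>x. x \<in> S", OF S] dfn_term_subst1[OF F])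
  from definable_function[OF this] obtain G where G: "dfn_term (\<lambda>e. G (e 0))"
    "\<forall>a b. (b \<in> S \<and> F b = a) \<and> (\<forall>b'. b' \<in> S \<and> F b' = a \<longrightarrow> b' = b) \<longrightarrow> G a = b"
    by blast
  have "G (F a) = a" if "a \<in> S" for a
    using G(2)[THEN spec, THEN spec, THEN mp, of a "F a"] that inj by (auto dest: inj_onD)
  with G(1) show ?thesis by blast
qed

section \<open>Bijections as sets and as class functions\<close>

definition equipotent :: "'v \<Rightarrow> 'v \<Rightarrow> bool" where
  "equipotent x y \<longleftrightarrow> (\<exists>f. is_bijection f x y)"

lemma dfn_equipotent [dfn]: "dfn_term t \<Longrightarrow> dfn_term u \<Longrightarrow> dfn_pred (\<lambda>e. equipotent (t e) (u e))"
  by (rule dfn_subst2[where P = equipotent])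
    (simp_all only: equipotent_def is_bijection_def is_pair_iff, intro dfn)

text \<open>Exchanges coded bijections for HOL functions, so that \<open>bij_betw\<close> can do the
  combinatorics. The way back uses Replacement: the graph of a class function on a set is a
  set.\<close>

lemma equipotent_iff:
  "equipotent x y \<longleftrightarrow> (\<exists>F. dfn_term (\<lambda>e. F (e 0)) \<and> bij_betw F (elts x) (elts y))"
proof
  assume "equipotent x y"
  then obtain f where f: "is_bijection f x y" unfolding equipotent_def by blast
  have "dfn_pred (\<lambda>e. e 0 \<in> elts x \<and> e 1 \<in> elts y \<and> pr (e 0) (e 1) \<in> elts f)"
    by (intro dfn)
  from definable_function[OF this] obtain F where F: "dfn_term (\<lambda>e. F (e 0))"
    and *: "\<And>a b. a \<in> elts x \<Longrightarrow> b \<in> elts y \<Longrightarrow> pr a b \<in> elts f \<Longrightarrow>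
      (\<And>b'. b' \<in> elts y \<Longrightarrow> pr a b' \<in> elts f \<Longrightarrow> b' = b) \<Longrightarrow> F a = b"
    by blast
  have f1: "\<exists>!b. b \<in> elts y \<and> pr a b \<in> elts f" if "a \<in> elts x" for a
    using f that unfolding is_bijection_def is_pair_iff by auto
  have f2: "\<exists>!a. a \<in> elts x \<and> pr a b \<in> elts f" if "b \<in> elts y" for b
    using f that unfolding is_bijection_def is_pair_iff by auto
  have F1: "F a \<in> elts y \<and> pr a (F a) \<in> elts f" if a: "a \<in> elts x" for a
  proof -
    obtain b where b: "b \<in> elts y" "pr a b \<in> elts f"
      "\<forall>b'. b' \<in> elts y \<and> pr a b' \<in> elts f \<longrightarrow> b' = b"
      using f1[OF a] by blast
    then have "F a = b" using *[OF a b(1,2)] by blast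
    with b(1,2) show ?thesis by simp
  qed
  have "bij_betw F (elts x) (elts y)"
  proof (rule bij_betw_imageI)
    show "inj_on F (elts x)"
    proof (rule inj_onI)
      fix a a' assume a: "a \<in> elts x" "a' \<in> elts x" "F a = F a'"
      then have "pr a (F a) \<in> elts f" "pr a' (F a) \<in> elts f"
        using F1[OF a(1)] F1[OF a(2)] a(3) by simp_all
      with f2[of "F a"] F1[OF a(1)] a(1,2) show "a = a'" by blast
    qed
    show "F ` elts x = elts y"
    proof
      show "F ` elts x \<subseteq> elts y" using F1 by blast
      show "elts y \<subseteq> F ` elts x"
      proof
        fix b assume b: "b \<in> elts y"
        then obtain a where a: "a \<in> elts x" "pr a b \<in> elts f" using f2 by blast
        with f1[OF a(1)] F1[OF a(1)] b have "b = F a" by blast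
        with a show "b \<in> F ` elts x" by blast
      qed
    qed
  qed
  with F show "\<exists>F. dfn_term (\<lambda>e. F (e 0)) \<and> bij_betw F (elts x) (elts y)" by blast
next
  assume "\<exists>F. dfn_term (\<lambda>e. F (e 0)) \<and> bij_betw F (elts x) (elts y)"
  then obtain F where F: "dfn_term (\<lambda>e. F (e 0))" and b: "bij_betw F (elts x) (elts y)" by blast
  have "dfn_term (\<lambda>e. pr (e 0) (F (e 0)))" by (intro dfn F)
  then have "isset ((\<lambda>a. pr a (F a)) ` elts x)" by (rule isset_image)
  then obtain f where f: "elts f = (\<lambda>a. pr a (F a)) ` elts x" unfolding isset_def by blast
  have mem_f: "(\<exists>p\<in>elts f. p = pr a b) \<longleftrightarrow> a \<in> elts x \<and> b = F a" for a b
    unfolding f by auto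
  have "is_bijection f x y"
    unfolding is_bijection_def is_pair_iff mem_f
  proof (intro conjI ballI)
    fix p assume "p \<in> elts f"
    with b show "\<exists>a\<in>elts x. \<exists>b\<in>elts y. p = pr a b" unfolding f by (auto simp: bij_betw_def)
  next
    fix a assume "a \<in> elts x"
    with b show "\<exists>!b. b \<in> elts y \<and> a \<in> elts x \<and> b = F a" by (auto simp: bij_betw_def)
  next
    fix c assume "c \<in> elts y"
    with b show "\<exists>!a. a \<in> elts x \<and> a \<in> elts x \<and> c = F a" by (auto simp: bij_betw_def dest: inj_onD)
  qed
  then show "equipotent x y" unfolding equipotent_def by blast
qed

lemma equipotentI: "dfn_term (\<lambda>e. F (e 0)) \<Longrightarrow> bij_betw F (elts x) (elts y) \<Longrightarrow> equipotent x y"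
  using equipotent_iff by blast

lemma equipotent_trans: "equipotent x y \<Longrightarrow> equipotent y z \<Longrightarrow> equipotent x z"
proof -
  assume "equipotent x y" "equipotent y z"
  then obtain F G where F: "dfn_term (\<lambda>e. F (e 0))" "bij_betw F (elts x) (elts y)"
    and G: "dfn_term (\<lambda>e. G (e 0))" "bij_betw G (elts y) (elts z)"
    unfolding equipotent_iff by blast
  show ?thesis
  proof (rule equipotentI[where F = "G \<circ> F"])
    show "dfn_term (\<lambda>e. (G \<circ> F) (e 0))" unfolding o_def by (rule dfn_term_subst1[OF G(1) F(1)])
  qed (rule bij_betw_trans[OF F(2) G(2)])
qed

lemma equipotent_sym:
  assumes "equipotent x y"
  shows "equipotent y x"
proof -
  obtain F where F: "dfn_term (\<lambda>e. F (e 0))" and b: "bij_betw F (elts x) (elts y)"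
    using assms unfolding equipotent_iff by blast
  have "dfn_pred (\<lambda>e. e 0 \<in> elts x)" by (intro dfn)
  from definable_inverse[OF F this] b
  obtain G where G: "dfn_term (\<lambda>e. G (e 0))" "\<forall>a\<in>elts x. G (F a) = a"
    unfolding bij_betw_def by blast
  have "bij_betw G (elts y) (elts x)"
  proof (rule bij_betw_byWitness[where f' = F])
    have y: "elts y = F ` elts x" using b unfolding bij_betw_def by blast
    show "\<forall>c\<in>elts y. F (G c) = c" "G ` elts y \<subseteq> elts x" unfolding y using G(2) by auto
    show "\<forall>a\<in>elts x. G (F a) = a" "F ` elts x \<subseteq> elts y" unfolding y using G(2) by auto
  qed
  with G(1) show ?thesis by (rule equipotentI)
qed

text \<open>The selection is made only from the members of a given set \<open>K\<close>. The axiom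
  asks for a disjoint family, so each \<open>B\<close> is replaced by its copy {B} \<times> B, built
  by \<open>T\<close>.\<close>

lemma choice:
  "\<exists>F. dfn_term (\<lambda>e. F (e 0)) \<and> (\<forall>B\<in>elts K. elts B \<noteq> {} \<longrightarrow> F B \<in> elts B)"
proof -
  define T where "T B = vset {p. \<exists>b\<in>elts B. p = pr B b}" for B
  have T: "dfn_term (\<lambda>e. T (e 0))" unfolding T_def by (intro dfn)
  have T_elts: "elts (T B) = (\<lambda>b. pr B b) ` elts B" for B
  proof -
    have "isset ((\<lambda>b. pr B b) ` elts B)" by (rule isset_image) (intro dfn)
    moreover have "{p. \<exists>b\<in>elts B. p = pr B b} = (\<lambda>b. pr B b) ` elts B" by auto
    ultimately show ?thesis unfolding T_def by (simp add: elts_vset)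
  qed
  have "isset ({B. \<exists>b. b \<in> elts B} \<inter> elts K)" by (rule isset_Int) (intro dfn)
  then obtain K' where K': "elts K' = {B. \<exists>b. b \<in> elts B} \<inter> elts K" unfolding isset_def by blast
  obtain \<F> where \<F>: "elts \<F> = T ` elts K'" using isset_image[OF T] unfolding isset_def by blast
  have ne: "elts x \<noteq> {}" if "x \<in> elts \<F>" for x
    using that unfolding \<F> K' by (auto simp: T_elts)
  have disj: "elts x \<inter> elts y = {}" if "x \<in> elts \<F>" "y \<in> elts \<F>" "x \<noteq> y" for x y
    using that unfolding \<F> by (auto simp: T_elts)
  from transversal[OF ne disj] obtain t
    where t: "\<forall>x\<in>elts \<F>. \<exists>!z. z \<in> elts x \<and> z \<in> elts t" by (rule exE)
  have "dfn_pred (\<lambda>e. e 1 \<in> elts (e 0) \<and> pr (e 0) (e 1) \<in> elts t)" by (intro dfn)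
  from definable_function[OF this] obtain F where F: "dfn_term (\<lambda>e. F (e 0))"
    "\<And>B b. (b \<in> elts B \<and> pr B b \<in> elts t) \<and> (\<forall>b'. b' \<in> elts B \<and> pr B b' \<in> elts t \<longrightarrow> b' = b) \<Longrightarrow> F B = b"
    by blast
  have "F B \<in> elts B" if "B \<in> elts K" "elts B \<noteq> {}" for B
  proof -
    have "T B \<in> elts \<F>" using that unfolding \<F> K' by blast
    then have "\<exists>!z. z \<in> elts (T B) \<and> z \<in> elts t" by (rule bspec[OF t])
    then obtain z where z: "z \<in> elts (T B)" "z \<in> elts t"
      "\<And>z'. z' \<in> elts (T B) \<Longrightarrow> z' \<in> elts t \<Longrightarrow> z' = z" by blast
    from z(1) obtain b where b: "b \<in> elts B" "z = pr B b" unfolding T_elts by blast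
    have "b' = b" if "b' \<in> elts B" "pr B b' \<in> elts t" for b'
      using z(3)[of "pr B b'"] that b unfolding T_elts by simp
    then have "F B = b" using b z(2) by (intro F(2)) blast
    with b(1) show ?thesis by simp
  qed
  with F(1) show ?thesis by blast
qed

text \<open>Zermelo's argument: \<open>H\<close> picks at each ordinal an element of
  \<open>x\<close> not picked before. The least ordinal at which \<open>x\<close> is exhausted is
  mapped bijectively onto \<open>x\<close>.\<close>

lemma well_ordering: "\<exists>\<alpha>. ordinal \<alpha> \<and> equipotent \<alpha> x"
proof -
  obtain K where K: "elts K = {y. elts y \<subseteq> elts x}" using isset_Pow unfolding isset_def by blast
  obtain ch where ch: "dfn_term (\<lambda>e. ch (e 0))" "\<forall>B\<in>elts K. elts B \<noteq> {} \<longrightarrow> ch B \<in> elts B"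
    using choice by blast
  define G where "G s = ch (vset (elts x - elts s))" for s
  have "dfn_term (\<lambda>e. G (e 0))" unfolding G_def by (intro dfn dfn_term_subst1[OF ch(1)])
  from ordinal_recursion[OF this] obtain H where H: "dfn_term (\<lambda>e. H (e 0))"
    and rec: "\<And>\<alpha>. ordinal \<alpha> \<Longrightarrow> H \<alpha> = G (vset (H ` elts \<alpha>))" by blast
  note [dfn] = dfn_term_subst1[OF H]
  have new: "H \<alpha> \<in> elts x \<and> H \<alpha> \<notin> H ` elts \<alpha>" if "ordinal \<alpha>" "\<not> elts x \<subseteq> H ` elts \<alpha>" for \<alpha>
  proof -
    have s: "isset (elts x - H ` elts \<alpha>)"
    proof (rule isset_subset)
      have "dfn_pred (\<lambda>e. e 0 \<in> elts x - {y. \<exists>\<gamma>\<in>elts \<alpha>. y = H \<gamma>})" by (intro dfn)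
      moreover have "{y. \<exists>\<gamma>\<in>elts \<alpha>. y = H \<gamma>} = H ` elts \<alpha>" by auto
      ultimately show "dfn_pred (\<lambda>e. e 0 \<in> elts x - H ` elts \<alpha>)" by simp
    qed blast
    have "H \<alpha> = ch (vset (elts x - H ` elts \<alpha>))"
      using rec[OF that(1)] unfolding G_def by (simp add: elts_vset isset_image[OF H])
    moreover have "vset (elts x - H ` elts \<alpha>) \<in> elts K" "elts (vset (elts x - H ` elts \<alpha>)) \<noteq> {}"
      using that(2) unfolding K by (auto simp: elts_vset[OF s])
    ultimately show ?thesis using ch(2) elts_vset[OF s] by auto
  qed
  have inj: "inj_on H S" if "\<And>\<alpha>. \<alpha> \<in> S \<Longrightarrow> ordinal \<alpha> \<and> \<not> elts x \<subseteq> H ` elts \<alpha>" for S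
  proof (rule inj_onI)
    fix \<alpha> \<beta> assume *: "\<alpha> \<in> S" "\<beta> \<in> S" "H \<alpha> = H \<beta>"
    then have "\<alpha> \<in> elts \<beta> \<or> \<alpha> = \<beta> \<or> \<beta> \<in> elts \<alpha>" using that ordinal_linear by blast
    moreover have "\<alpha> \<notin> elts \<beta>"
      using new[of \<beta>] that[of \<beta>] *(2,3) by (metis imageI)
    moreover have "\<beta> \<notin> elts \<alpha>"
      using new[of \<alpha>] that[of \<alpha>] *(1,3) by (metis imageI)
    ultimately show "\<alpha> = \<beta>" by blast
  qed
  \<comment> \<open>The image under \<open>H\<close> is spelled out as a comprehension, the form
    covered by the \<open>dfn\<close> rules.\<close>
  define S where "S = {\<alpha>. ordinal \<alpha> \<and> elts x \<subseteq> {y. \<exists>\<gamma>\<in>elts \<alpha>. y = H \<gamma>}}"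
  have S: "\<alpha> \<in> S \<longleftrightarrow> ordinal \<alpha> \<and> elts x \<subseteq> H ` elts \<alpha>" for \<alpha>
    unfolding S_def by (auto simp: image_def)
  have "\<exists>\<alpha>. \<alpha> \<in> S"
  proof (rule ccontr)
    assume no: "\<not> ?thesis"
    then have new': "H \<alpha> \<in> elts x" if "ordinal \<alpha>" for \<alpha>
      using new that S by blast
    \<comment> \<open>If \<open>x\<close> were never exhausted, \<open>H\<close> would inject all
      ordinals into \<open>x\<close>, and Replacement along its inverse would make them a
      set.\<close>
    have "dfn_pred (\<lambda>e. e 0 \<in> {\<alpha>. ordinal \<alpha>})" by (intro dfn)
    from definable_inverse[OF H this inj] no S
    obtain F where F: "dfn_term (\<lambda>e. F (e 0))" "\<forall>\<alpha>\<in>{\<alpha>. ordinal \<alpha>}. F (H \<alpha>) = \<alpha>" by blast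
    have "isset ({\<alpha>. ordinal \<alpha>} \<inter> elts (vset (F ` elts x)))" by (rule isset_Int) (intro dfn)
    moreover have "{\<alpha>. ordinal \<alpha>} \<inter> elts (vset (F ` elts x)) = {\<alpha>. ordinal \<alpha>}"
    proof (intro equalityI subsetI IntI)
      fix \<alpha> assume \<alpha>: "\<alpha> \<in> {\<alpha>. ordinal \<alpha>}"
      then show "\<alpha> \<in> elts (vset (F ` elts x))"
        unfolding elts_vset[OF isset_image[OF F(1)]]
        using F(2) new'[of \<alpha>] by (intro image_eqI[of _ _ "H \<alpha>"]) auto
    qed auto
    ultimately show False using ordinals_not_set by simp
  qed
  then obtain \<alpha>' where "ordinal \<alpha>'" "\<alpha>' \<in> S" using S by blast
  moreover have "dfn_pred (\<lambda>e. e 0 \<in> S)" unfolding S_def by (intro dfn)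
  ultimately obtain \<alpha> where \<alpha>: "ordinal \<alpha>" "\<alpha> \<in> S" "\<And>\<beta>. \<beta> \<in> S \<Longrightarrow> \<beta> \<notin> elts \<alpha>"
    using ordinal_least by blast
  have small: "ordinal \<beta> \<and> \<not> elts x \<subseteq> H ` elts \<beta>" if "\<beta> \<in> elts \<alpha>" for \<beta>
    using that \<alpha>(3) S ordinal_elt[OF \<alpha>(1) that] by blast
  have "bij_betw H (elts \<alpha>) (elts x)"
  proof (rule bij_betw_imageI[OF inj])
    show "H ` elts \<alpha> = elts x" using \<alpha>(2) S small new by blast
  qed (rule small)
  with H \<alpha>(1) show ?thesis using equipotentI by blast
qed

lemma ex_cardinality: "\<exists>\<mu>. has_cardinality x \<mu>"
proof -
  obtain \<alpha> where \<alpha>: "ordinal \<alpha>" "equipotent \<alpha> x" using well_ordering by blast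
  define S where "S = {\<alpha>. ordinal \<alpha> \<and> equipotent x \<alpha>}"
  have "dfn_pred (\<lambda>e. e 0 \<in> S)" unfolding S_def by (intro dfn)
  moreover have "\<alpha> \<in> S" using \<alpha> equipotent_sym unfolding S_def by blast
  ultimately obtain \<mu> where \<mu>: "ordinal \<mu>" "\<mu> \<in> S" "\<And>\<beta>. \<beta> \<in> S \<Longrightarrow> \<beta> \<notin> elts \<mu>"
    using ordinal_least \<alpha>(1) by blast
  have "\<not> equipotent \<beta> \<mu>" if "\<beta> \<in> elts \<mu>" for \<beta>
  proof
    assume "equipotent \<beta> \<mu>"
    then have "equipotent x \<beta>"
      using \<mu>(2) equipotent_trans equipotent_sym unfolding S_def by blast
    then show False using \<mu>(3)[of \<beta>] that ordinal_elt[OF \<mu>(1) that] unfolding S_def by blast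
  qed
  with \<mu>(1,2) have "has_cardinality x \<mu>"
    unfolding has_cardinality_def cardinal_def equipotent_def S_def by blast
  then show ?thesis by blast
qed

text \<open>\<open>F\<close> moves the closure \<open>Z\<close> of k - m under \<open>F\<close>, and
  everything else stays fixed. What \<open>Z\<close> loses under this map is exactly k - m.\<close>

lemma Schroeder_Bernstein:
  assumes F: "dfn_term (\<lambda>e. F (e 0))" and inj: "inj_on F (elts k)"
    and Fm: "F ` elts k \<subseteq> elts m" and mk: "elts m \<subseteq> elts k"
  shows "equipotent k m"
proof -
  note [dfn] = dfn_term_subst1[OF F]
  \<comment> \<open>The closure is taken from above, as the intersection of all closed sets; this is
    a formula and needs no iteration over numbers.\<close>
  define Z where "Z = {z. z \<in> elts k \<and>
    (\<forall>W. elts k - elts m \<subseteq> elts W \<and> (\<forall>w\<in>elts W. F w \<in> elts W) \<longrightarrow> z \<in> elts W)}"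
  have Zdfn: "dfn_pred (\<lambda>e. e 0 \<in> Z)" unfolding Z_def by (intro dfn)
  note [dfn] = dfn_subst1[where P = "\<lambda>x. x \<in> Z", OF Zdfn]
  have Z: "isset Z" by (rule isset_subset[OF Zdfn, of k]) (auto simp: Z_def)
  have Z1: "elts k - elts m \<subseteq> Z" and Zk: "Z \<subseteq> elts k" unfolding Z_def by auto
  have Z2: "F z \<in> Z" if "z \<in> Z" for z using that Fm mk unfolding Z_def by auto
  have Z3: "z \<in> F ` Z" if z: "z \<in> Z" "z \<in> elts m" for z
  proof -
    have "isset (F ` elts (vset Z))" by (rule isset_image[OF F])
    then have s1: "isset (F ` Z)" by (simp add: elts_vset Z)
    have "isset (elts k - elts m)"
      by (rule isset_subset[of _ k]) (auto intro!: dfn)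
    then have "isset ((elts k - elts m) \<union> F ` Z)" using s1 by (rule isset_Un)
    \<comment> \<open>This \<open>W\<close> is closed, so minimality of \<open>Z\<close> puts
      \<open>z\<close> into it.\<close>
    then obtain W where W: "elts W = (elts k - elts m) \<union> F ` Z"
      unfolding isset_def by (rule exE)
    have "elts k - elts m \<subseteq> elts W \<and> (\<forall>w\<in>elts W. F w \<in> elts W)"
      unfolding W using Z1 Z2 by blast
    moreover have "(elts k - elts m \<subseteq> elts W \<and> (\<forall>w\<in>elts W. F w \<in> elts W)) \<longrightarrow> z \<in> elts W"
      using z(1) unfolding Z_def by simp
    ultimately have "z \<in> elts W" by (rule rev_mp)
    with z(2) W show ?thesis by blast
  qed
  define g where "g a = (if a \<in> Z then F a else a)" for a
  have "dfn_term (\<lambda>e. g (e 0))" unfolding g_def by (intro dfn)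
  moreover have "bij_betw g (elts k) (elts m)"
  proof (rule bij_betw_imageI)
    show "inj_on g (elts k)"
    proof (rule inj_onI)
      fix a b assume *: "a \<in> elts k" "b \<in> elts k" "g a = g b"
      then have "a \<in> Z \<longleftrightarrow> b \<in> Z" using Z2[of a] Z2[of b] unfolding g_def by metis
      with * show "a = b" using inj_onD[OF inj, of a b] unfolding g_def by (cases "a \<in> Z") simp_all
    qed
    show "g ` elts k = elts m"
    proof
      show "g ` elts k \<subseteq> elts m" using Fm Z1 unfolding g_def by auto
      show "elts m \<subseteq> g ` elts k"
      proof
        fix b assume b: "b \<in> elts m"
        show "b \<in> g ` elts k"
        proof (cases "b \<in> Z")
          case True
          then obtain z where "z \<in> Z" "b = F z" using Z3 b by blast
          then show ?thesis using Zk unfolding g_def by (intro image_eqI[of _ _ z]) auto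
        next
          case False
          then show ?thesis using b mk unfolding g_def by (intro image_eqI[of _ _ b]) auto
        qed
      qed
    qed
  qed
  ultimately show ?thesis by (rule equipotentI)
qed

section \<open>Sets of size less than \<kappa>\<close>

lemma cardinal_iff: "cardinal \<mu> \<longleftrightarrow> ordinal \<mu> \<and> (\<forall>\<alpha>\<in>elts \<mu>. \<not> equipotent \<alpha> \<mu>)"
  by (simp only: cardinal_def equipotent_def)

lemma card_less_iff: "card_less x \<kappa> \<longleftrightarrow> (\<exists>\<mu>. cardinal \<mu> \<and> equipotent x \<mu> \<and> \<mu> \<in> elts \<kappa>)"
  by (simp only: card_less_def has_cardinality_def equipotent_def mem_elts conj_assoc)

lemma dfn_card_less [dfn]: "dfn_term t \<Longrightarrow> dfn_term u \<Longrightarrow> dfn_pred (\<lambda>e. card_less (t e) (u e))"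
  by (rule dfn_subst2[where P = card_less]) (simp_all only: card_less_iff cardinal_iff, intro dfn)

lemma card_less_equipotent: "card_less x \<kappa> \<Longrightarrow> equipotent y x \<Longrightarrow> card_less y \<kappa>"
  unfolding card_less_iff using equipotent_trans by blast

text \<open>Otherwise |y| is at least \<kappa>, and \<kappa> injects through \<open>y\<close> and
  \<open>x\<close> into some \<mu> < \<kappa>. By \<open>Schroeder_Bernstein\<close> it is then
  equipotent to \<mu>, so not a cardinal.\<close>

lemma card_less_subset:
  assumes \<kappa>: "cardinal \<kappa>" and x: "card_less x \<kappa>" and yx: "elts y \<subseteq> elts x"
  shows "card_less y \<kappa>"
proof (rule ccontr)
  assume no: "\<not> ?thesis"
  obtain \<nu> where \<nu>: "cardinal \<nu>" "equipotent y \<nu>"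
    using ex_cardinality[of y] unfolding has_cardinality_def equipotent_def by blast
  obtain \<mu> where \<mu>: "cardinal \<mu>" "equipotent x \<mu>" "\<mu> \<in> elts \<kappa>"
    using x unfolding card_less_iff by blast
  have "\<nu> \<notin> elts \<kappa>"
    using no \<nu> unfolding card_less_iff by blast
  then have \<kappa>\<nu>: "elts \<kappa> \<subseteq> elts \<nu>"
    using ordinal_linear[of \<nu> \<kappa>] \<nu>(1) \<kappa> ordinal_trans[of \<nu> \<kappa>] unfolding cardinal_iff by blast
  obtain F where F: "dfn_term (\<lambda>e. F (e 0))" "bij_betw F (elts \<nu>) (elts y)"
    using equipotent_sym[OF \<nu>(2)] unfolding equipotent_iff by blast
  obtain G where G: "dfn_term (\<lambda>e. G (e 0))" "bij_betw G (elts x) (elts \<mu>)"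
    using \<mu>(2) unfolding equipotent_iff by blast
  have "equipotent \<kappa> \<mu>"
  proof (rule Schroeder_Bernstein[where F = "G \<circ> F"])
    show "dfn_term (\<lambda>e. (G \<circ> F) (e 0))" unfolding o_def by (rule dfn_term_subst1[OF G(1) F(1)])
    have Fx: "F ` elts \<kappa> \<subseteq> elts x" using \<kappa>\<nu> F(2) yx by (auto simp: bij_betw_def)
    have inj: "inj_on F (elts \<nu>)" "inj_on G (elts x)" and G': "G ` elts x = elts \<mu>"
      using F(2) G(2) unfolding bij_betw_def by blast+
    show "inj_on (G \<circ> F) (elts \<kappa>)"
      by (rule comp_inj_on[OF inj_on_subset[OF inj(1) \<kappa>\<nu>] inj_on_subset[OF inj(2) Fx]])
    show "(G \<circ> F) ` elts \<kappa> \<subseteq> elts \<mu>"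
      using Fx unfolding image_comp[symmetric] G'[symmetric] by (rule image_mono)
    show "elts \<mu> \<subseteq> elts \<kappa>"
      using ordinal_trans[OF _ \<mu>(3)] \<kappa> unfolding cardinal_iff by blast
  qed
  then show False
    using \<kappa> \<mu>(3) equipotent_sym unfolding cardinal_iff by blast
qed

text \<open>Choosing one preimage for each element of \<open>y\<close> makes \<open>y\<close>
  equipotent to a subset of \<open>x\<close>.\<close>

lemma card_less_image:
  assumes \<kappa>: "cardinal \<kappa>" and x: "card_less x \<kappa>"
    and F: "dfn_term (\<lambda>e. F (e 0))" and y: "elts y = F ` elts x"
  shows "card_less y \<kappa>"
proof -
  note [dfn] = dfn_term_subst1[OF F]
  define fib where "fib b = vset ({a. F a = b} \<inter> elts x)" for b
  have fib: "dfn_term (\<lambda>e. fib (e 0))" unfolding fib_def by (intro dfn)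
  have fib_elts: "elts (fib b) = {a. F a = b} \<inter> elts x" for b
    unfolding fib_def by (intro elts_vset isset_Int) (intro dfn)
  obtain K where K: "elts K = fib ` elts y" using isset_image[OF fib] unfolding isset_def by blast
  obtain ch where ch: "dfn_term (\<lambda>e. ch (e 0))" "\<forall>B\<in>elts K. elts B \<noteq> {} \<longrightarrow> ch B \<in> elts B"
    using choice by blast
  define P where "P b = ch (fib b)" for b
  have P: "dfn_term (\<lambda>e. P (e 0))" unfolding P_def by (rule dfn_term_subst1[OF ch(1) fib])
  have P1: "F (P b) = b \<and> P b \<in> elts x" if "b \<in> elts y" for b
  proof -
    have "elts (fib b) \<noteq> {}" using that unfolding y fib_elts by auto
    moreover have "fib b \<in> elts K" using that unfolding K by blast
    ultimately have "P b \<in> elts (fib b)" using ch(2) unfolding P_def by blast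
    then show ?thesis unfolding fib_elts by blast
  qed
  obtain z where z: "elts z = P ` elts y" using isset_image[OF P] unfolding isset_def by blast
  have "elts z \<subseteq> elts x" using P1 unfolding z by blast
  then have "card_less z \<kappa>" by (rule card_less_subset[OF \<kappa> x])
  moreover have "equipotent y z"
  proof (rule equipotentI[OF P])
    show "bij_betw P (elts y) (elts z)"
      unfolding z using P1 by (intro bij_betw_imageI) (auto intro!: inj_on_inverseI[where g = F])
  qed
  ultimately show ?thesis by (rule card_less_equipotent)
qed

end

section \<open>Levels of an inner model\<close>

text \<open>M serves as the class predicate of V, so V may collect by formulas that mention M. In
  \<open>M_zfc\<close> the predicate is empty: inside M only pure membership formulas are
  available.\<close>

locale inner_model = universe mem M for mem :: "'v \<Rightarrow> 'v \<Rightarrow> bool" and M :: "'v set" +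
  assumes M_transitive: "transitive_class M" and M_proper: "proper_class M" and M_zfc: "ZFC M mem {}"
begin

section \<open>The axioms inside M\<close>

lemma M_elts: "x \<in> M \<Longrightarrow> y \<in> elts x \<Longrightarrow> y \<in> M"
  using M_transitive unfolding transitive_class_def by blast

lemma M_nonempty: "M \<noteq> {}"
proof
  assume "M = {}"
  then show False
    using M_proper isset_empty unfolding proper_class_def belongs_def isset_def by simp
qed

abbreviation dfn_M :: "((nat \<Rightarrow> 'v) \<Rightarrow> bool) \<Rightarrow> bool" where
  "dfn_M \<equiv> definable M mem {}"

lemmas dfn_M_intros = definable_Neg definable_Conj definable_Disj definable_Imp definable_Iff
  definable_Ball definable_Bex definable_Eq atomic_var[OF M_nonempty] atomic_const

lemma dfn_M_elts: "atomic_term M t \<Longrightarrow> atomic_term M u \<Longrightarrow> dfn_M (\<lambda>e. t e \<in> elts (u e))"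
  unfolding elts_def mem_Collect_eq by (rule definable_Mem)

lemma M_separation:
  assumes "dfn_M (\<lambda>e. P (e 0))" and x: "x \<in> M"
  shows "\<exists>y\<in>M. elts y = {z \<in> elts x. P z}"
proof -
  obtain y where y: "y \<in> M" "\<And>z. z \<in> M \<Longrightarrow> mem z y \<longleftrightarrow> mem z x \<and> P z"
    using ZFC_separation[OF M_zfc assms(1) x] by blast
  have "elts y = {z \<in> elts x. P z}"
    using y(2) M_elts[OF y(1)] M_elts[OF x] by (auto simp: mem_elts)
  with y(1) show ?thesis by blast
qed

lemma M_replacement:
  assumes "dfn_M (\<lambda>e. R (e 0) (e 1))" and x: "x \<in> M"
    and "\<And>u. u \<in> elts x \<Longrightarrow> \<exists>!v. v \<in> M \<and> R u v"
  shows "\<exists>y\<in>M. elts y = {v \<in> M. \<exists>u\<in>elts x. R u v}"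
proof -
  have "\<exists>!v. v \<in> M \<and> R u v" if "u \<in> M" "mem u x" for u
    using assms(3) that(2) by (simp add: mem_elts)
  from ZFC_replacement[OF M_zfc assms(1) x this]
  obtain y where y: "y \<in> M" "\<And>v. v \<in> M \<Longrightarrow> mem v y \<longleftrightarrow> (\<exists>u\<in>M. mem u x \<and> R u v)"
    by blast
  have y': "v \<in> elts y \<longleftrightarrow> (\<exists>u\<in>elts x. R u v)" if "v \<in> M" for v
    using y(2)[OF that] M_elts[OF x] unfolding elts_def by blast
  have "elts y = {v \<in> M. \<exists>u\<in>elts x. R u v}"
    using y' M_elts[OF y(1)] by blast
  with y(1) show ?thesis by blast
qed

lemma M_Union:
  assumes x: "x \<in> M"
  shows "\<exists>u\<in>M. elts u = (\<Union>y\<in>elts x. elts y)"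
proof -
  have "\<exists>u\<in>M. \<forall>z\<in>M. mem z u \<longleftrightarrow> (\<exists>y\<in>M. mem y x \<and> mem z y)"
    using M_zfc[unfolded ZFC_def, THEN conjunct2, THEN conjunct2, THEN conjunct2, THEN conjunct1] x
    by (rule bspec)
  then obtain u where u: "u \<in> M" "\<And>z. z \<in> M \<Longrightarrow> z \<in> elts u \<longleftrightarrow> (\<exists>y\<in>M. y \<in> elts x \<and> z \<in> elts y)"
    unfolding elts_def mem_Collect_eq by blast
  have "elts u = (\<Union>y\<in>elts x. elts y)"
  proof (intro equalityI subsetI)
    fix z assume "z \<in> elts u"
    with u(2)[OF M_elts[OF u(1) this]] show "z \<in> (\<Union>y\<in>elts x. elts y)" by blast
  next
    fix z assume "z \<in> (\<Union>y\<in>elts x. elts y)"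
    then obtain y where y: "y \<in> elts x" "z \<in> elts y" by blast
    with u(2)[of z] M_elts[OF x y(1)] M_elts[OF M_elts[OF x y(1)] y(2)] show "z \<in> elts u" by blast
  qed
  with u(1) show ?thesis by blast
qed

lemma M_Pow:
  assumes x: "x \<in> M"
  shows "\<exists>p\<in>M. elts p = {z \<in> M. elts z \<subseteq> elts x}"
proof -
  have "\<exists>p\<in>M. \<forall>z\<in>M. mem z p \<longleftrightarrow> (\<forall>w\<in>M. mem w z \<longrightarrow> mem w x)"
    using M_zfc[unfolded ZFC_def, THEN conjunct2, THEN conjunct2, THEN conjunct2, THEN conjunct2,
        THEN conjunct1] x
    by (rule bspec)
  then obtain p where p: "p \<in> M" "\<And>z. z \<in> M \<Longrightarrow> z \<in> elts p \<longleftrightarrow> (\<forall>w\<in>M. w \<in> elts z \<longrightarrow> w \<in> elts x)"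
    unfolding elts_def mem_Collect_eq by blast
  have "elts p = {z \<in> M. elts z \<subseteq> elts x}"
  proof (intro equalityI subsetI CollectI conjI)
    fix z assume z: "z \<in> elts p"
    then show zM: "z \<in> M" using M_elts[OF p(1)] by blast
    fix w assume "w \<in> elts z"
    with p(2)[OF zM] z M_elts[OF zM this] show "w \<in> elts x" by blast
  next
    fix z assume "z \<in> {z \<in> M. elts z \<subseteq> elts x}"
    with p(2)[of z] show "z \<in> elts p" by blast
  qed
  with p(1) show ?thesis by blast
qed

lemma M_Int:
  assumes "x \<in> M" and "y \<in> M"
  shows "\<exists>z\<in>M. elts z = elts x \<inter> elts y"
proof -
  have "dfn_M (\<lambda>e. e 0 \<in> elts y)" by (intro dfn_M_elts dfn_M_intros assms)
  from M_separation[OF this assms(1)] show ?thesis by (simp add: Int_def)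
qed

text \<open>Histories and levels in the sense of Button's Level Theory, relativized to \<open>M\<close>: the levels are
  the stages of the cumulative hierarchy of \<open>M\<close>, obtained without ordinals or recursion.\<close>

definition history :: "'v \<Rightarrow> bool" where
  "history h \<longleftrightarrow> (\<forall>x\<in>M. x \<in> elts h \<longrightarrow>
     (\<forall>z\<in>M. z \<in> elts x \<longleftrightarrow>
       (\<exists>c\<in>M. c \<in> elts x \<and> c \<in> elts h \<and> (\<forall>w\<in>M. w \<in> elts z \<longrightarrow> w \<in> elts c))))"

text \<open>In the intended case \<open>h\<close> consists of the levels below \<open>s\<close>, and
  \<open>s\<close> collects the sets of M included in one of them. All quantifiers are bounded by M,
  so the same text is a formula of M and, through the class predicate, a formula of V.\<close>

definition level :: "'v \<Rightarrow> bool" where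
  "level s \<longleftrightarrow> s \<in> M \<and> (\<exists>h\<in>M. history h \<and>
     (\<forall>z\<in>M. z \<in> elts s \<longleftrightarrow> (\<exists>c\<in>M. c \<in> elts h \<and> (\<forall>w\<in>M. w \<in> elts z \<longrightarrow> w \<in> elts c))))"

text \<open>Plays the part of the rank of \<open>y\<close>: it is unique, so Replacement in M can be
  applied to it.\<close>

definition least_level :: "'v \<Rightarrow> 'v \<Rightarrow> bool" where
  "least_level y l \<longleftrightarrow> level l \<and> (\<forall>w\<in>M. w \<in> elts y \<longrightarrow> w \<in> elts l) \<and>
     (\<forall>k\<in>M. k \<in> elts l \<and> level k \<longrightarrow> \<not> (\<forall>w\<in>M. w \<in> elts y \<longrightarrow> w \<in> elts k))"

lemma dfn_M_level: "dfn_M (\<lambda>e. level (e i))"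
proof (rule definable_cong)
  show "dfn_M (\<lambda>e. \<exists>h\<in>M. history h \<and> (\<forall>z\<in>M. z \<in> elts (e i) \<longleftrightarrow>
      (\<exists>c\<in>M. c \<in> elts h \<and> (\<forall>w\<in>M. w \<in> elts z \<longrightarrow> w \<in> elts c))))"
    unfolding history_def by (intro dfn_M_elts dfn_M_intros)
qed (auto simp: level_def)

lemma dfn_M_least_level: "dfn_M (\<lambda>e. least_level (e i) (e j))"
  unfolding least_level_def by (intro dfn_M_elts dfn_M_level dfn_M_intros)

lemma dfn_level [dfn]: "dfn_term t \<Longrightarrow> dfn_pred (\<lambda>e. level (t e))"
  by (rule dfn_subst1[where P = level]) (simp_all only: level_def history_def, intro dfn)

lemma dfn_least_level [dfn]:
  "dfn_term t \<Longrightarrow> dfn_term u \<Longrightarrow> dfn_pred (\<lambda>e. least_level (t e) (u e))"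
  by (rule dfn_subst2[where P = least_level]) (simp_all only: least_level_def, intro dfn)

lemma M_subset: "x \<in> M \<Longrightarrow> (\<forall>w\<in>M. w \<in> elts x \<longrightarrow> w \<in> elts y) \<longleftrightarrow> elts x \<subseteq> elts y"
  using M_elts by blast

lemma history_iff:
  assumes h: "h \<in> M"
  shows "history h \<longleftrightarrow>
    (\<forall>x\<in>elts h. \<forall>z\<in>M. z \<in> elts x \<longleftrightarrow> (\<exists>c\<in>elts x \<inter> elts h. elts z \<subseteq> elts c))"
proof -
  have "(\<exists>c\<in>M. c \<in> elts x \<and> c \<in> elts h \<and> (\<forall>w\<in>M. w \<in> elts z \<longrightarrow> w \<in> elts c)) \<longleftrightarrow>
      (\<exists>c\<in>elts x \<inter> elts h. elts z \<subseteq> elts c)" if "z \<in> M" for x z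
    unfolding M_subset[OF that] using M_elts[OF h] by blast
  then have "history h \<longleftrightarrow> (\<forall>x\<in>M. x \<in> elts h \<longrightarrow>
      (\<forall>z\<in>M. z \<in> elts x \<longleftrightarrow> (\<exists>c\<in>elts x \<inter> elts h. elts z \<subseteq> elts c)))"
    unfolding history_def by simp
  also have "\<dots> \<longleftrightarrow> (\<forall>x\<in>elts h. \<forall>z\<in>M. z \<in> elts x \<longleftrightarrow> (\<exists>c\<in>elts x \<inter> elts h. elts z \<subseteq> elts c))"
    using M_elts[OF h] by auto
  finally show ?thesis .
qed

lemma level_iff:
  "level s \<longleftrightarrow> s \<in> M \<and> (\<exists>h\<in>M. history h \<and>
     (\<forall>z\<in>M. z \<in> elts s \<longleftrightarrow> (\<exists>c\<in>elts h. elts z \<subseteq> elts c)))"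
proof -
  have "(\<exists>c\<in>M. c \<in> elts h \<and> (\<forall>w\<in>M. w \<in> elts z \<longrightarrow> w \<in> elts c)) \<longleftrightarrow>
      (\<exists>c\<in>elts h. elts z \<subseteq> elts c)" if "h \<in> M" "z \<in> M" for h z
    unfolding M_subset[OF that(2)] using M_elts[OF that(1)] by blast
  then show ?thesis unfolding level_def by simp
qed

lemma least_level_iff:
  assumes y: "y \<in> M"
  shows "least_level y l \<longleftrightarrow>
    level l \<and> elts y \<subseteq> elts l \<and> (\<forall>k\<in>elts l. level k \<longrightarrow> \<not> elts y \<subseteq> elts k)"
  unfolding least_level_def M_subset[OF y] using level_def by blast

lemma level_in_M: "level s \<Longrightarrow> s \<in> M"
  by (simp add: level_def)

text \<open>Let d be a minimal member of \<open>h\<close> that is not transitive. An element x of d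
  is included in some b in both d and \<open>h\<close>, and b is transitive. So elements of x are
  included in b, which puts them back into d.\<close>

lemma history_elt_trans:
  assumes h: "h \<in> M" "history h" and c: "c \<in> elts h" and x: "x \<in> elts c"
  shows "elts x \<subseteq> elts c"
proof (rule ccontr)
  assume bad: "\<not> ?thesis"
  define S where "S = {c. \<exists>x\<in>elts c. \<not> elts x \<subseteq> elts c} \<inter> elts h"
  have "isset S" unfolding S_def by (rule isset_Int) (intro dfn)
  moreover have "c \<in> S" unfolding S_def using c x bad by blast
  ultimately obtain d where d: "d \<in> S" "\<forall>b\<in>S. b \<notin> elts d" using foundation by blast
  then obtain x where dh: "d \<in> elts h" and x: "x \<in> elts d" "\<not> elts x \<subseteq> elts d" unfolding S_def by blast
  have d_iff: "z \<in> elts d \<longleftrightarrow> (\<exists>c\<in>elts d \<inter> elts h. elts z \<subseteq> elts c)" if "z \<in> M" for z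
    using h(2)[unfolded history_iff[OF h(1)]] dh that by blast
  have xM: "x \<in> M" using M_elts[OF M_elts[OF h(1) dh] x(1)] .
  then obtain b where b: "b \<in> elts d" "b \<in> elts h" "elts x \<subseteq> elts b" using d_iff x(1) by blast
  have b_trans: "elts y \<subseteq> elts b" if "y \<in> elts b" for y
    using d(2) b(1,2) that unfolding S_def by blast
  have "y \<in> elts d" if "y \<in> elts x" for y
    using d_iff[OF M_elts[OF xM that]] b b_trans that by blast
  with x(2) show False by blast
qed

lemma level_potent: "level s \<Longrightarrow> x \<in> elts s \<Longrightarrow> y \<in> M \<Longrightarrow> elts y \<subseteq> elts x \<Longrightarrow> y \<in> elts s"
proof -
  assume s: "level s" and x: "x \<in> elts s" and y: "y \<in> M" "elts y \<subseteq> elts x"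
  obtain h where h: "\<forall>z\<in>M. z \<in> elts s \<longleftrightarrow> (\<exists>c\<in>elts h. elts z \<subseteq> elts c)"
    using s unfolding level_iff by blast
  have "x \<in> M" using M_elts[OF level_in_M[OF s] x] .
  with h x obtain c where "c \<in> elts h" "elts x \<subseteq> elts c" by blast
  with h y show "y \<in> elts s" by blast
qed

lemma level_trans: "level s \<Longrightarrow> x \<in> elts s \<Longrightarrow> y \<in> elts x \<Longrightarrow> y \<in> elts s"
proof -
  assume s: "level s" and x: "x \<in> elts s" and y: "y \<in> elts x"
  obtain h where h: "h \<in> M" "history h" "\<forall>z\<in>M. z \<in> elts s \<longleftrightarrow> (\<exists>c\<in>elts h. elts z \<subseteq> elts c)"
    using s unfolding level_iff by blast
  have xM: "x \<in> M" using M_elts[OF level_in_M[OF s] x] .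
  with h(3) x obtain c where c: "c \<in> elts h" "elts x \<subseteq> elts c" by blast
  have "elts y \<subseteq> elts c" using history_elt_trans[OF h(1,2) c(1)] c(2) y by blast
  with h(3) c(1) M_elts[OF xM y] show "y \<in> elts s" by blast
qed

text \<open>The witnessing history for \<open>c\<close> is the part of \<open>h\<close> inside
  \<open>c\<close>; since the members of \<open>h\<close> are transitive, cutting down to
  \<open>c\<close> does not change the condition on its members.\<close>

lemma history_level:
  assumes h: "h \<in> M" "history h" and c: "c \<in> elts h"
  shows "level c"
proof -
  have cM: "c \<in> M" using M_elts[OF h(1) c] .
  obtain h' where h': "h' \<in> M" "elts h' = elts c \<inter> elts h" using M_Int[OF cM h(1)] by blast
  note hist = h(2)[unfolded history_iff[OF h(1)]]
  have "history h'"
    unfolding history_iff[OF h'(1)]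
  proof (intro ballI)
    fix x z assume x: "x \<in> elts h'" and z: "z \<in> M"
    have "elts x \<inter> elts h' = elts x \<inter> elts h"
      using x h'(2) history_elt_trans[OF h c] by blast
    moreover have "z \<in> elts x \<longleftrightarrow> (\<exists>c\<in>elts x \<inter> elts h. elts z \<subseteq> elts c)"
      using hist x z h'(2) by blast
    ultimately show "z \<in> elts x \<longleftrightarrow> (\<exists>c\<in>elts x \<inter> elts h'. elts z \<subseteq> elts c)" by simp
  qed
  moreover have "\<forall>z\<in>M. z \<in> elts c \<longleftrightarrow> (\<exists>c\<in>elts h'. elts z \<subseteq> elts c)"
    using hist c unfolding h'(2) by blast
  ultimately show ?thesis unfolding level_iff using cM h'(1) by blast
qed

text \<open>Removes the witnessing history: a level is determined by the levels that are its
  elements.\<close>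

lemma level_elts:
  assumes s: "level s" and x: "x \<in> M"
  shows "x \<in> elts s \<longleftrightarrow> (\<exists>l\<in>elts s. level l \<and> elts x \<subseteq> elts l)"
proof
  obtain h where h: "h \<in> M" "history h" "\<forall>z\<in>M. z \<in> elts s \<longleftrightarrow> (\<exists>c\<in>elts h. elts z \<subseteq> elts c)"
    using s unfolding level_iff by blast
  assume "x \<in> elts s"
  with h(3) x obtain c where c: "c \<in> elts h" "elts x \<subseteq> elts c" by blast
  have "c \<in> elts s" using h(3) M_elts[OF h(1) c(1)] c(1) by blast
  with c history_level[OF h(1,2) c(1)] show "\<exists>l\<in>elts s. level l \<and> elts x \<subseteq> elts l" by blast
next
  assume "\<exists>l\<in>elts s. level l \<and> elts x \<subseteq> elts l"
  then show "x \<in> elts s" using level_potent[OF s _ x] by blast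
qed

text \<open>Double minimality: s' is a minimal level incomparable with some level, and t' a minimal
  level incomparable with s'. Both then have the same levels as elements, so
  \<open>level_elts\<close> makes them equal.\<close>

lemma level_linear:
  assumes "level s" and "level t"
  shows "s \<in> elts t \<or> s = t \<or> t \<in> elts s"
proof (rule ccontr)
  assume bad: "\<not> ?thesis"
  define S where "S = {s. level s \<and> (\<exists>t. level t \<and> \<not> (s \<in> elts t \<or> s = t \<or> t \<in> elts s))}"
  have "dfn_pred (\<lambda>e. e 0 \<in> S)" unfolding S_def by (intro dfn)
  moreover have "s \<in> S" unfolding S_def using assms bad by blast
  ultimately obtain s' where s': "s' \<in> S" "\<And>z. z \<in> elts s' \<Longrightarrow> z \<notin> S"
    using class_foundation by blast
  define T where "T = {t. level t \<and> \<not> (s' \<in> elts t \<or> s' = t \<or> t \<in> elts s')}"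
  have "dfn_pred (\<lambda>e. e 0 \<in> T)" unfolding T_def by (intro dfn)
  moreover obtain t0 where "t0 \<in> T" using s'(1) unfolding S_def T_def by blast
  ultimately obtain t' where t': "t' \<in> T" "\<And>z. z \<in> elts t' \<Longrightarrow> z \<notin> T"
    using class_foundation by blast
  have ls: "level s'" and lt: "level t'" and no: "s' \<notin> elts t'" "s' \<noteq> t'" "t' \<notin> elts s'"
    using s'(1) t'(1) unfolding S_def T_def by blast+
  have 1: "r \<in> elts t'" if r: "r \<in> elts s'" "level r" for r
  proof -
    have "r \<in> elts t' \<or> r = t' \<or> t' \<in> elts r" using s'(2)[OF r(1)] r(2) lt unfolding S_def by blast
    then show ?thesis using no(3) r(1) level_trans[OF ls r(1)] by blast
  qed
  have 2: "r \<in> elts s'" if r: "r \<in> elts t'" "level r" for r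
  proof -
    have "s' \<in> elts r \<or> s' = r \<or> r \<in> elts s'" using t'(2)[OF r(1)] r(2) unfolding T_def by blast
    then show ?thesis using no(1) r(1) level_trans[OF lt r(1)] by blast
  qed
  have "x \<in> elts s' \<longleftrightarrow> x \<in> elts t'" if "x \<in> M" for x
    unfolding level_elts[OF ls that] level_elts[OF lt that] using 1 2 by blast
  then have "elts s' = elts t'" using M_elts[OF level_in_M[OF ls]] M_elts[OF level_in_M[OF lt]] by blast
  with no(2) show False using elts_inject by blast
qed

lemma ex1_least_level:
  assumes y: "y \<in> M" and k: "level k" "elts y \<subseteq> elts k"
  shows "\<exists>!l. l \<in> M \<and> least_level y l"
proof (rule ex_ex1I)
  define S where "S = {l. level l \<and> elts y \<subseteq> elts l}"
  have "dfn_pred (\<lambda>e. e 0 \<in> S)" unfolding S_def by (intro dfn)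
  moreover have "k \<in> S" unfolding S_def using k by blast
  ultimately obtain l where l: "l \<in> S" "\<And>z. z \<in> elts l \<Longrightarrow> z \<notin> S" using class_foundation by blast
  then have "least_level y l" unfolding least_level_iff[OF y] S_def by blast
  then show "\<exists>l. l \<in> M \<and> least_level y l" using least_level_def level_in_M by blast
next
  fix l l' assume "l \<in> M \<and> least_level y l" "l' \<in> M \<and> least_level y l'"
  then show "l = l'" unfolding least_level_iff[OF y] using level_linear[of l l'] by blast
qed

text \<open>Let a be a minimal set of M without such a level. Replacement in M collects the least
  levels of the elements of a; these and all levels below them form a history, and the level it
  generates includes a.\<close>

lemma ex_level:
  assumes "x \<in> M"
  shows "\<exists>l. level l \<and> elts x \<subseteq> elts l"
proof (rule ccontr)
  assume no: "\<not> ?thesis"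
  define S where "S = {x. x \<in> M \<and> \<not> (\<exists>l. level l \<and> elts x \<subseteq> elts l)}"
  have "dfn_pred (\<lambda>e. e 0 \<in> S)" unfolding S_def by (intro dfn)
  moreover have "x \<in> S" unfolding S_def using assms no by blast
  ultimately obtain a where a: "a \<in> S" "\<And>z. z \<in> elts a \<Longrightarrow> z \<notin> S" using class_foundation by blast
  then have aM: "a \<in> M" unfolding S_def by blast
  have "\<exists>!l. l \<in> M \<and> least_level y l" if y: "y \<in> elts a" for y
  proof -
    have "y \<in> M" using M_elts[OF aM y] .
    moreover from this obtain k where "level k" "elts y \<subseteq> elts k"
      using a(2)[OF y] unfolding S_def by blast
    ultimately show ?thesis by (rule ex1_least_level)
  qed
  from M_replacement[OF dfn_M_least_level aM this]
  obtain H where H: "H \<in> M" "elts H = {l \<in> M. \<exists>y\<in>elts a. least_level y l}" by blast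
  have H_level: "level l" if "l \<in> elts H" for l using that H(2) unfolding least_level_def by blast
  have H_cover: "\<exists>l\<in>elts H. elts y \<subseteq> elts l" if y: "y \<in> elts a" for y
  proof -
    have yM: "y \<in> M" using M_elts[OF aM y] .
    obtain k where "level k" "elts y \<subseteq> elts k" using a(2)[OF y] yM unfolding S_def by blast
    from ex1_implies_ex[OF ex1_least_level[OF yM this]]
    obtain l where l: "l \<in> M" "least_level y l" by blast
    then have "l \<in> elts H" unfolding H(2) using y by blast
    moreover have "elts y \<subseteq> elts l" using l(2)[unfolded least_level_iff[OF yM]] by (elim conjE)
    ultimately show ?thesis by blast
  qed
  \<comment> \<open>Levels are transitive, so every level in or below \<open>H\<close> is a subset
    of \<open>U\<close>. This makes \<open>P\<close> a bound for both applications of Separation in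
    M that follow.\<close>
  obtain U where U: "U \<in> M" "elts U = (\<Union>l\<in>elts H. elts l)" using M_Union[OF H(1)] by blast
  obtain P where P: "P \<in> M" "elts P = {z \<in> M. elts z \<subseteq> elts U}" using M_Pow[OF U(1)] by blast
  have "dfn_M (\<lambda>e. level (e 0) \<and> (\<exists>k\<in>M. k \<in> elts H \<and> (e 0 = k \<or> e 0 \<in> elts k)))"
    using H(1) by (intro dfn_M_elts dfn_M_level dfn_M_intros)
  from M_separation[OF this P(1)] obtain h where h: "h \<in> M"
    "elts h = {l \<in> elts P. level l \<and> (\<exists>k\<in>M. k \<in> elts H \<and> (l = k \<or> l \<in> elts k))}" by blast
  have h_elts: "l \<in> elts h \<longleftrightarrow> level l \<and> (\<exists>k\<in>elts H. l = k \<or> l \<in> elts k)" for l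
  proof -
    have "elts l \<subseteq> elts U" if "k \<in> elts H" "l = k \<or> l \<in> elts k" for k
      unfolding U(2) using that level_trans[OF H_level[OF that(1)]] by blast
    then have "l \<in> elts P" if "level l" "k \<in> elts H" "l = k \<or> l \<in> elts k" for k
      unfolding P(2) using that level_in_M by blast
    moreover have "(\<exists>k\<in>M. k \<in> elts H \<and> (l = k \<or> l \<in> elts k)) \<longleftrightarrow> (\<exists>k\<in>elts H. l = k \<or> l \<in> elts k)"
      using M_elts[OF H(1)] by blast
    ultimately show ?thesis unfolding h(2) by blast
  qed
  have h_down: "c \<in> elts h" if l: "l \<in> elts h" and c: "c \<in> elts l" "level c" for l c
  proof -
    obtain k where k: "k \<in> elts H" "l = k \<or> l \<in> elts k" using l h_elts by blast
    then have "c \<in> elts k" using c(1) level_trans[OF H_level[OF k(1)]] by blast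
    with k(1) c(2) h_elts show ?thesis by blast
  qed
  have hist: "history h"
    unfolding history_iff[OF h(1)]
  proof (intro ballI)
    fix l z assume l: "l \<in> elts h" and z: "z \<in> M"
    then have "level l" using h_elts by blast
    have "{c \<in> elts l. level c} = elts l \<inter> elts h"
      using h_down[OF l] h_elts by blast
    then show "z \<in> elts l \<longleftrightarrow> (\<exists>c\<in>elts l \<inter> elts h. elts z \<subseteq> elts c)"
      unfolding level_elts[OF \<open>level l\<close> z] by blast
  qed
  have "dfn_M (\<lambda>e. \<exists>c\<in>M. c \<in> elts h \<and> (\<forall>w\<in>M. w \<in> elts (e 0) \<longrightarrow> w \<in> elts c))"
    using h(1) by (intro dfn_M_elts dfn_M_intros)
  from M_separation[OF this P(1)] obtain s where s: "s \<in> M"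
    "elts s = {z \<in> elts P. \<exists>c\<in>M. c \<in> elts h \<and> (\<forall>w\<in>M. w \<in> elts z \<longrightarrow> w \<in> elts c)}" by blast
  have s_elts: "z \<in> elts s \<longleftrightarrow> (\<exists>c\<in>elts h. elts z \<subseteq> elts c)" if z: "z \<in> M" for z
  proof -
    have hU: "elts c \<subseteq> elts U" if "c \<in> elts h" for c
      using that h(2) P(2) by blast
    have P': "z \<in> elts P" if ex: "\<exists>c\<in>elts h. elts z \<subseteq> elts c"
    proof -
      obtain c where "c \<in> elts h" "elts z \<subseteq> elts c" using ex by blast
      then have "elts z \<subseteq> elts U" using hU by blast
      with z show ?thesis unfolding P(2) by blast
    qed
    have "(\<exists>c\<in>M. c \<in> elts h \<and> (\<forall>w\<in>M. w \<in> elts z \<longrightarrow> w \<in> elts c)) \<longleftrightarrow>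
        (\<exists>c\<in>elts h. elts z \<subseteq> elts c)"
      unfolding M_subset[OF z] using M_elts[OF h(1)] by blast
    with P' show ?thesis unfolding s(2) mem_Collect_eq by argo
  qed
  have "\<forall>z\<in>M. z \<in> elts s \<longleftrightarrow> (\<exists>c\<in>elts h. elts z \<subseteq> elts c)" using s_elts by blast
  then have "level s" unfolding level_iff using s(1) h(1) hist by blast
  moreover have "elts a \<subseteq> elts s"
  proof
    fix y assume y: "y \<in> elts a"
    then obtain l where l: "l \<in> elts H" "elts y \<subseteq> elts l" using H_cover by blast
    then have "l \<in> elts h" using h_elts H_level by blast
    with l(2) s_elts[OF M_elts[OF aM y]] show "y \<in> elts s" by blast
  qed
  ultimately show False using a(1) unfolding S_def by blast
qed

text \<open>If no level includes A, then for every level some element of A lies outside it, and the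
  least level of that element includes the given one. The union \<open>U\<close> of these least
  levels would then include every set of M, so M would be contained in the power set of
  \<open>U\<close>, although it is a proper class.\<close>

lemma bounded_in_M:
  assumes A: "elts A \<subseteq> M"
  shows "\<exists>X\<in>M. elts A \<subseteq> elts X"
proof (rule ccontr)
  assume no: "\<not> ?thesis"
  have "dfn_pred (\<lambda>e. least_level (e 0) (e 1))" by (intro dfn)
  from definable_function[OF this] obtain F where F: "dfn_term (\<lambda>e. F (e 0))"
    and F': "\<And>y l. least_level y l \<Longrightarrow> (\<forall>l'. least_level y l' \<longrightarrow> l' = l) \<Longrightarrow> F y = l" by blast
  have F_level: "level (F y)" and F_cover: "elts y \<subseteq> elts (F y)" if y: "y \<in> M" for y
  proof -
    obtain k where "level k" "elts y \<subseteq> elts k" using ex_level[OF y] by blast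
    from ex1_least_level[OF y this]
    obtain l where l: "least_level y l" "\<forall>l'. l' \<in> M \<and> least_level y l' \<longrightarrow> l' = l"
      unfolding Ex1_def by blast
    have "\<forall>l'. least_level y l' \<longrightarrow> l' = l" using l(2) level_in_M unfolding least_level_def by blast
    with l(1) have "F y = l" by (rule F')
    with l(1) show "level (F y)" "elts y \<subseteq> elts (F y)" unfolding least_level_iff[OF y] by auto
  qed
  obtain U where U: "elts U = (\<Union>y\<in>elts A. elts (F y))"
    using isset_UN[OF F] unfolding isset_def by blast
  have "elts x \<subseteq> elts U" if x: "x \<in> M" for x
  proof -
    obtain l where l: "level l" "elts x \<subseteq> elts l" using ex_level[OF x] by blast
    obtain a where a: "a \<in> elts A" "a \<notin> elts l" using no level_in_M[OF l(1)] by blast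
    then have aM: "a \<in> M" using A by blast
    have "F a \<notin> elts l" using a(2) level_potent[OF l(1) _ aM F_cover[OF aM]] by blast
    then have "l = F a \<or> l \<in> elts (F a)" using level_linear[OF F_level[OF aM] l(1)] by blast
    then have "elts l \<subseteq> elts (F a)" using level_trans[OF F_level[OF aM]] by blast
    with a(1) l(2) U show ?thesis by blast
  qed
  then have "M \<subseteq> elts (vset {y. elts y \<subseteq> elts U})" by (auto simp: elts_vset isset_Pow)
  then have "isset M" by (rule isset_subset[rotated]) (intro dfn)
  then show False using M_proper unfolding proper_class_def belongs_def isset_def by blast
qed

end

section \<open>Ultrafilters\<close>

context universe
begin

section \<open>Ultrafilters in V\<close>

lemma ultrafilterD:
  assumes "ultrafilter U X"
  shows ultrafilter_subset: "A \<in> elts U \<Longrightarrow> elts A \<subseteq> elts X"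
    and ultrafilter_top: "X \<in> elts U"
    and ultrafilter_nonempty: "A \<in> elts U \<Longrightarrow> elts A \<noteq> {}"
    and ultrafilter_mono: "A \<in> elts U \<Longrightarrow> elts A \<subseteq> elts B \<Longrightarrow> elts B \<subseteq> elts X \<Longrightarrow> B \<in> elts U"
    and ultrafilter_Int: "A \<in> elts U \<Longrightarrow> B \<in> elts U \<Longrightarrow> belongs (elts A \<inter> elts B) (elts U)"
    and ultrafilter_compl: "elts A \<subseteq> elts X \<Longrightarrow> A \<in> elts U \<or> belongs (elts X - elts A) (elts U)"
proof -
  have u: "\<forall>A\<in>elts U. elts A \<subseteq> elts X" "X \<in> elts U" "\<forall>A\<in>elts U. elts A \<noteq> {}"
    "\<forall>A\<in>elts U. \<forall>B. elts A \<subseteq> elts B \<and> elts B \<subseteq> elts X \<longrightarrow> B \<in> elts U"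
    "\<forall>A\<in>elts U. \<forall>B\<in>elts U. belongs (elts A \<inter> elts B) (elts U)"
    "\<forall>A. elts A \<subseteq> elts X \<longrightarrow> A \<in> elts U \<or> belongs (elts X - elts A) (elts U)"
    using assms unfolding ultrafilter_def by - (elim conjE, assumption)+
  show "A \<in> elts U \<Longrightarrow> elts A \<subseteq> elts X" by (rule bspec[OF u(1)])
  show "X \<in> elts U" by (rule u(2))
  show "A \<in> elts U \<Longrightarrow> elts A \<noteq> {}" by (rule bspec[OF u(3)])
  show "A \<in> elts U \<Longrightarrow> elts A \<subseteq> elts B \<Longrightarrow> elts B \<subseteq> elts X \<Longrightarrow> B \<in> elts U"
    using u(4) by blast
  show "A \<in> elts U \<Longrightarrow> B \<in> elts U \<Longrightarrow> belongs (elts A \<inter> elts B) (elts U)"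
    using u(5) by blast
  show "elts A \<subseteq> elts X \<Longrightarrow> A \<in> elts U \<or> belongs (elts X - elts A) (elts U)"
    using u(6) by blast
qed

lemma complete_ultrafilterD:
  assumes "complete_ultrafilter \<kappa> U X"
  shows "ultrafilter U X"
    and "elts S \<subseteq> elts U \<Longrightarrow> elts S \<noteq> {} \<Longrightarrow> card_less S \<kappa> \<Longrightarrow> belongs (\<Inter>A\<in>elts S. elts A) (elts U)"
  using assms unfolding complete_ultrafilter_def by blast+

lemma belongs_elts: "belongs (elts x) N \<longleftrightarrow> x \<in> N"
  unfolding belongs_def elts_inject by simp

lemma ultrafilter_compl_iff:
  assumes U: "ultrafilter U X" and B: "elts B \<subseteq> elts X" and B': "elts B' = elts X - elts B"
  shows "B' \<in> elts U \<longleftrightarrow> B \<notin> elts U"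
proof
  assume "B' \<in> elts U"
  show "B \<notin> elts U"
  proof
    assume "B \<in> elts U"
    with ultrafilter_Int[OF U \<open>B' \<in> elts U\<close>]
    obtain y where "y \<in> elts U" "elts y = elts B' \<inter> elts B" unfolding belongs_def by blast
    with ultrafilter_nonempty[OF U] B' show False by blast
  qed
next
  assume "B \<notin> elts U"
  with ultrafilter_compl[OF U B] show "B' \<in> elts U" unfolding B'[symmetric] belongs_elts by blast
qed

text \<open>Preimages commute with intersections and with complements, since \<open>h\<close> maps
  \<open>P\<close> into \<open>Y\<close>. For completeness, the preimages of a small family form an
  image of that family and so are again a small family.\<close>

lemma complete_ultrafilter_image:
  assumes \<kappa>: "cardinal \<kappa>" and W: "complete_ultrafilter \<kappa> W P"
    and h: "dfn_term (\<lambda>e. h (e 0))" and hY: "h ` elts P \<subseteq> elts Y"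
    and D: "\<And>B. B \<in> elts D \<longleftrightarrow> elts B \<subseteq> elts Y \<and> vset ({\<sigma>. h \<sigma> \<in> elts B} \<inter> elts P) \<in> elts W"
  shows "complete_ultrafilter \<kappa> D Y"
proof -
  note uf = complete_ultrafilterD(1)[OF W]
  note [dfn] = dfn_term_subst1[OF h]
  define inv where "inv B = vset ({\<sigma>. h \<sigma> \<in> elts B} \<inter> elts P)" for B
  have inv_dfn: "dfn_term (\<lambda>e. inv (e 0))" unfolding inv_def by (intro dfn)
  have inv: "elts (inv B) = {\<sigma>. h \<sigma> \<in> elts B} \<inter> elts P" for B
    unfolding inv_def by (intro elts_vset isset_Int) (intro dfn)
  have D': "B \<in> elts D \<longleftrightarrow> elts B \<subseteq> elts Y \<and> inv B \<in> elts W" for B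
    unfolding D inv_def ..
  have inv_eq: "inv B = w" if "elts w = {\<sigma>. h \<sigma> \<in> elts B} \<inter> elts P" for w B
    using that inv elts_inject by metis
  show ?thesis
    unfolding complete_ultrafilter_def ultrafilter_def
  proof (intro conjI ballI allI impI)
    show "elts A \<subseteq> elts Y" if "A \<in> elts D" for A using that D' by blast
    have "inv Y = P" by (rule inv_eq) (use hY in blast)
    then show "Y \<in> elts D" using ultrafilter_top[OF uf] D' by simp
    show "elts A \<noteq> {}" if "A \<in> elts D" for A
    proof -
      have "elts (inv A) \<noteq> {}" using that D' ultrafilter_nonempty[OF uf] by blast
      then show ?thesis unfolding inv by blast
    qed
    show "B \<in> elts D" if A: "A \<in> elts D" and B: "elts A \<subseteq> elts B \<and> elts B \<subseteq> elts Y" for A B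
    proof -
      have "inv B \<in> elts W"
      proof (rule ultrafilter_mono[OF uf])
        show "inv A \<in> elts W" using A D' by blast
        show "elts (inv A) \<subseteq> elts (inv B)" "elts (inv B) \<subseteq> elts P" unfolding inv using B by blast+
      qed
      then show ?thesis using B D' by blast
    qed
    show "belongs (elts A \<inter> elts B) (elts D)" if A: "A \<in> elts D" and B: "B \<in> elts D" for A B
    proof -
      have "isset (elts A \<inter> elts B)" by (rule isset_Int) (intro dfn)
      then obtain y where y: "elts y = elts A \<inter> elts B" unfolding isset_def by blast
      have "belongs (elts (inv A) \<inter> elts (inv B)) (elts W)"
        using A B D' ultrafilter_Int[OF uf] by blast
      moreover have "elts (inv A) \<inter> elts (inv B) = elts (inv y)" unfolding inv y by blast
      ultimately have "inv y \<in> elts W" by (simp add: belongs_elts)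
      moreover have "elts y \<subseteq> elts Y" unfolding y using A D' by blast
      ultimately have "y \<in> elts D" using D' by blast
      then show ?thesis unfolding y[symmetric] belongs_elts .
    qed
    show "A \<in> elts D \<or> belongs (elts Y - elts A) (elts D)" if A: "elts A \<subseteq> elts Y" for A
    proof -
      have "isset (elts Y - elts A)" by (rule isset_subset[of _ Y]) (auto intro!: dfn)
      then obtain y where y: "elts y = elts Y - elts A" unfolding isset_def by blast
      have "elts (inv y) = elts P - elts (inv A)" unfolding inv y using hY by blast
      moreover have "elts (inv A) \<subseteq> elts P" unfolding inv by blast
      ultimately have "inv y \<in> elts W \<longleftrightarrow> inv A \<notin> elts W"
        using ultrafilter_compl_iff[OF uf] by blast
      then have "A \<in> elts D \<or> y \<in> elts D" unfolding D' using A y by blast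
      then show ?thesis unfolding y[symmetric] belongs_elts .
    qed
    show "belongs (\<Inter>A\<in>elts S. elts A) (elts D)"
      if S: "elts S \<subseteq> elts D \<and> elts S \<noteq> {} \<and> card_less S \<kappa>" for S
    proof -
      have Sy: "\<Inter>(elts ` elts S) \<subseteq> elts Y" using S D' by blast
      have "dfn_pred (\<lambda>e. e 0 \<in> {z. \<forall>B\<in>elts S. z \<in> elts B})" by (intro dfn)
      moreover have "{z. \<forall>B\<in>elts S. z \<in> elts B} = \<Inter>(elts ` elts S)" by blast
      ultimately have "isset (\<Inter>(elts ` elts S))" using isset_subset[OF _ Sy] by simp
      then obtain y where y: "elts y = \<Inter>(elts ` elts S)" unfolding isset_def by blast
      obtain S' where S': "elts S' = inv ` elts S" using isset_image[OF inv_dfn] unfolding isset_def by blast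
      have "card_less S' \<kappa>" using card_less_image[OF \<kappa> _ inv_dfn S'] S by blast
      moreover have "elts S' \<subseteq> elts W" "elts S' \<noteq> {}" unfolding S' using S D' by blast+
      ultimately have "belongs (\<Inter>A\<in>elts S'. elts A) (elts W)"
        using complete_ultrafilterD(2)[OF W] by blast
      moreover have "(\<Inter>A\<in>elts S'. elts A) = elts (inv y)"
        unfolding S' inv y using S by (auto simp: inv)
      ultimately have "inv y \<in> elts W" by (simp add: belongs_elts)
      then have "y \<in> elts D" using D' Sy y by simp
      then show ?thesis unfolding y[symmetric] belongs_elts .
    qed
  qed
qed

end

context inner_model
begin

section \<open>From approximation to ultrafilters\<close>

lemma approximation_imp_ultrafilters:
  assumes \<kappa>: "cardinal \<kappa>" and approx: "approximation_property \<kappa> M"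
    and X: "X \<in> M" and U: "complete_ultrafilter \<kappa> U X"
  shows "belongs (elts U \<inter> M) M"
proof -
  note uf = complete_ultrafilterD(1)[OF U]
  have "isset (M \<inter> elts U)" by (rule isset_Int) (intro dfn)
  then obtain A where A: "elts A = M \<inter> elts U" unfolding isset_def by blast
  have "belongs (elts A \<inter> elts \<sigma>) M" if \<sigma>: "\<sigma> \<in> M" "card_less \<sigma> \<kappa>" for \<sigma>
  proof -
    have "isset ({B. elts B \<subseteq> elts X} \<inter> elts \<sigma>)" by (rule isset_Int) (intro dfn)
    then obtain \<sigma>' where \<sigma>': "elts \<sigma>' = {B. elts B \<subseteq> elts X} \<inter> elts \<sigma>" unfolding isset_def by blast
    \<comment> \<open>\<open>F B\<close> is whichever of B and X - B belongs to U, so one point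
      common to all of them decides membership in U for every B in \<sigma>' at once.\<close>
    define F where "F B = (if B \<in> elts U then B else vset (elts X - elts B))" for B
    have F: "dfn_term (\<lambda>e. F (e 0))" unfolding F_def by (intro dfn)
    have compl: "elts (vset (elts X - elts B)) = elts X - elts B" for B
      by (rule elts_vset, rule isset_subset[of _ X]) (auto intro!: dfn)
    have FU: "F B \<in> elts U" if "elts B \<subseteq> elts X" for B
      using ultrafilter_compl_iff[OF uf that compl] unfolding F_def by simp
    obtain S where S: "elts S = F ` elts \<sigma>'" using isset_image[OF F] unfolding isset_def by blast
    obtain x where x: "x \<in> elts X" "\<And>B. B \<in> elts \<sigma>' \<Longrightarrow> x \<in> elts (F B)"
    \<comment> \<open>Completeness speaks only of nonempty families; for an empty one any point of X
      will do.\<close>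
    proof (cases "elts \<sigma>' = {}")
      case True
      obtain x where "x \<in> elts X" using ultrafilter_nonempty[OF uf ultrafilter_top[OF uf]] by blast
      with True that show ?thesis by blast
    next
      case False
      have "card_less \<sigma>' \<kappa>" by (rule card_less_subset[OF \<kappa> \<sigma>(2)]) (use \<sigma>' in blast)
      then have "card_less S \<kappa>" using F S by (rule card_less_image[OF \<kappa>])
      moreover have "elts S \<subseteq> elts U" "elts S \<noteq> {}" using False FU unfolding S \<sigma>' by blast+
      ultimately have "belongs (\<Inter>A\<in>elts S. elts A) (elts U)"
        using complete_ultrafilterD(2)[OF U] by blast
      then obtain y where y: "y \<in> elts U" "elts y = (\<Inter>A\<in>elts S. elts A)" unfolding belongs_def by blast
      obtain x where x: "x \<in> elts y" using ultrafilter_nonempty[OF uf y(1)] by blast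
      show ?thesis
      proof (rule that)
        show "x \<in> elts X" using x ultrafilter_subset[OF uf y(1)] by blast
        show "x \<in> elts (F B)" if "B \<in> elts \<sigma>'" for B using x that unfolding y(2) S by blast
      qed
    qed
    have key: "B \<in> elts U \<longleftrightarrow> x \<in> elts B" if "B \<in> elts \<sigma>'" for B
    proof (cases "B \<in> elts U")
      case True
      with x(2)[OF that] show ?thesis unfolding F_def by simp
    next
      case False
      then have "x \<in> elts X - elts B" using x(2)[OF that] unfolding F_def by (simp add: compl)
      with False show ?thesis by blast
    qed
    have xM: "x \<in> M" using M_elts[OF X x(1)] .
    \<comment> \<open>Elements of \<sigma> that are not subsets of X may contain \<open>x\<close>
      too, so the formula excludes them.\<close>
    have "dfn_M (\<lambda>e. (\<forall>w\<in>M. w \<in> elts (e 0) \<longrightarrow> w \<in> elts X) \<and> x \<in> elts (e 0))"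
      using X xM by (intro dfn_M_elts dfn_M_intros)
    from M_separation[OF this \<sigma>(1)] obtain y where y: "y \<in> M"
      "elts y = {B \<in> elts \<sigma>. (\<forall>w\<in>M. w \<in> elts B \<longrightarrow> w \<in> elts X) \<and> x \<in> elts B}" by blast
    have "elts y = elts A \<inter> elts \<sigma>"
    proof (intro equalityI subsetI IntI)
      fix B assume B: "B \<in> elts y"
      then show "B \<in> elts \<sigma>" using y(2) by blast
      then have "B \<in> M" using M_elts[OF \<sigma>(1)] by blast
      then have "B \<in> elts \<sigma>'" using B M_subset[of B X] unfolding y(2) \<sigma>' by blast
      with key B \<open>B \<in> M\<close> show "B \<in> elts A" unfolding A y(2) by blast
    next
      fix B assume B: "B \<in> elts A \<inter> elts \<sigma>"
      then have "elts B \<subseteq> elts X" using ultrafilter_subset[OF uf] A by blast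
      then have "B \<in> elts \<sigma>'" using B \<sigma>' by blast
      with key B A \<open>elts B \<subseteq> elts X\<close> show "B \<in> elts y" unfolding y(2) by blast
    qed
    with y(1) show ?thesis unfolding belongs_def by blast
  qed
  then have "A \<in> M" using approx A unfolding approximation_property_def by blast
  then show ?thesis unfolding belongs_def using A by blast
qed

section \<open>From ultrafilters to approximation\<close>

lemma ultrafilters_imp_approximation:
  assumes \<kappa>: "strongly_compact \<kappa>" and cover: "cover_property \<kappa> M"
    and uf: "\<And>X U. X \<in> M \<Longrightarrow> complete_ultrafilter \<kappa> U X \<Longrightarrow> belongs (elts U \<inter> M) M"
    and AM: "elts A \<subseteq> M"
    and approx: "\<And>\<sigma>. \<sigma> \<in> M \<Longrightarrow> card_less \<sigma> \<kappa> \<Longrightarrow> belongs (elts A \<inter> elts \<sigma>) M"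
  shows "A \<in> M"
proof (cases "card_less A \<kappa>")
  case True
  then obtain \<tau> where \<tau>: "\<tau> \<in> M" "card_less \<tau> \<kappa>" "elts A \<subseteq> elts \<tau>"
    using cover AM unfolding cover_property_def by blast
  then have "elts A \<inter> elts \<tau> = elts A" by blast
  with approx[OF \<tau>(1,2)] show ?thesis by (simp add: belongs_elts)
next
  case False
  have card: "cardinal \<kappa>" using \<kappa> unfolding strongly_compact_def by blast
  obtain \<mu> where \<mu>: "cardinal \<mu>" "equipotent A \<mu>"
    using ex_cardinality[of A] unfolding has_cardinality_def equipotent_def by blast
  have "\<mu> \<notin> elts \<kappa>" using False \<mu> unfolding card_less_iff by blast
  then have "\<kappa> = \<mu> \<or> \<kappa> \<in> elts \<mu>"
    using ordinal_linear[of \<kappa> \<mu>] card \<mu>(1) unfolding cardinal_iff by blast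
  then obtain P W where P: "elts P = P_small \<kappa> \<mu>" and W: "complete_ultrafilter \<kappa> W P"
    and fine: "fine \<kappa> W \<mu>"
    using \<kappa> \<mu>(1) unfolding strongly_compact_def mem_elts[symmetric] by blast
  note ufW = complete_ultrafilterD(1)[OF W]
  obtain g where g: "dfn_term (\<lambda>e. g (e 0))" "bij_betw g (elts \<mu>) (elts A)"
    using equipotent_sym[OF \<mu>(2)] unfolding equipotent_iff by blast
  have gA: "g ` elts \<mu> = elts A" using g(2) unfolding bij_betw_def by blast
  obtain X where X: "X \<in> M" "elts A \<subseteq> elts X" using bounded_in_M[OF AM] by blast
  obtain Y where Y: "Y \<in> M" "elts Y = {z \<in> M. elts z \<subseteq> elts X}" using M_Pow[OF X(1)] by blast
  note [dfn] = dfn_term_subst1[OF g(1)]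
  \<comment> \<open>The candidates for h(\<sigma>). They are the traces A \<inter> \<tau> instead of
    the covers \<tau>, because those traces that lie in M are bounded by the set Y.\<close>
  define H where "H \<sigma> = vset ({b. \<exists>\<tau>\<in>M. card_less \<tau> \<kappa> \<and> (\<forall>\<alpha>\<in>elts \<sigma>. g \<alpha> \<in> elts \<tau>) \<and>
      b = vset (elts A \<inter> elts \<tau>)} \<inter> elts Y)" for \<sigma>
  have H: "dfn_term (\<lambda>e. H (e 0))" unfolding H_def by (intro dfn)
  have H_elts: "elts (H \<sigma>) = {b. \<exists>\<tau>\<in>M. card_less \<tau> \<kappa> \<and> (\<forall>\<alpha>\<in>elts \<sigma>. g \<alpha> \<in> elts \<tau>) \<and>
      b = vset (elts A \<inter> elts \<tau>)} \<inter> elts Y" for \<sigma>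
    unfolding H_def by (intro elts_vset isset_Int) (intro dfn)
  have A_Int: "elts (vset (elts A \<inter> elts \<tau>)) = elts A \<inter> elts \<tau>" for \<tau>
    by (intro elts_vset isset_Int) (intro dfn)
  \<comment> \<open>Both assumptions on M meet here: the cover property yields \<tau>, and the
    assumption on A puts A \<inter> \<tau> into M, hence into Y.\<close>
  have H_ne: "elts (H \<sigma>) \<noteq> {}" if \<sigma>: "\<sigma> \<in> elts P" for \<sigma>
  proof -
    have \<sigma>': "elts \<sigma> \<subseteq> elts \<mu>" "card_less \<sigma> \<kappa>" using \<sigma> unfolding P P_small_def by blast+
    obtain s where s: "elts s = g ` elts \<sigma>" using isset_image[OF g(1)] unfolding isset_def by blast
    have "card_less s \<kappa>" by (rule card_less_image[OF card \<sigma>'(2) g(1) s])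
    moreover have "elts s \<subseteq> M" unfolding s using \<sigma>'(1) gA AM by blast
    ultimately obtain \<tau> where \<tau>: "\<tau> \<in> M" "card_less \<tau> \<kappa>" "elts s \<subseteq> elts \<tau>"
      using cover unfolding cover_property_def by blast
    obtain b where b: "b \<in> M" "elts b = elts A \<inter> elts \<tau>"
      using approx[OF \<tau>(1,2)] unfolding belongs_def by blast
    have "b \<in> elts Y" unfolding Y(2) using b X(2) by blast
    moreover have "b = vset (elts A \<inter> elts \<tau>)" unfolding b(2)[symmetric] by simp
    moreover have "\<forall>\<alpha>\<in>elts \<sigma>. g \<alpha> \<in> elts \<tau>" using \<tau>(3) unfolding s by blast
    ultimately have "b \<in> elts (H \<sigma>)" unfolding H_elts using \<tau>(1,2) by blast
    then show ?thesis by blast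
  qed
  obtain K where K: "elts K = H ` elts P" using isset_image[OF H] unfolding isset_def by blast
  obtain ch where ch: "dfn_term (\<lambda>e. ch (e 0))" "\<forall>B\<in>elts K. elts B \<noteq> {} \<longrightarrow> ch B \<in> elts B"
    using choice by blast
  define h where "h \<sigma> = ch (H \<sigma>)" for \<sigma>
  have h: "dfn_term (\<lambda>e. h (e 0))" unfolding h_def by (rule dfn_term_subst1[OF ch(1) H])
  note [dfn] = dfn_term_subst1[OF h]
  have h_props: "h \<sigma> \<in> elts Y \<and> elts (h \<sigma>) \<subseteq> elts A \<and> g ` elts \<sigma> \<subseteq> elts (h \<sigma>)"
    if \<sigma>: "\<sigma> \<in> elts P" for \<sigma>
  proof -
    have "H \<sigma> \<in> elts K" using \<sigma> K by blast
    then have hH: "h \<sigma> \<in> elts (H \<sigma>)" using ch(2) H_ne[OF \<sigma>] unfolding h_def by blast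
    then obtain \<tau> where \<tau>: "\<forall>\<alpha>\<in>elts \<sigma>. g \<alpha> \<in> elts \<tau>" "h \<sigma> = vset (elts A \<inter> elts \<tau>)"
      unfolding H_elts by blast
    have e: "elts (h \<sigma>) = elts A \<inter> elts \<tau>" unfolding \<tau>(2) by (rule A_Int)
    have "elts \<sigma> \<subseteq> elts \<mu>" using \<sigma> unfolding P P_small_def by blast
    then have "g ` elts \<sigma> \<subseteq> elts A" using gA by blast
    with e \<tau>(1) hH show ?thesis unfolding H_elts by blast
  qed
  have "isset ({B. vset ({\<sigma>. h \<sigma> \<in> elts B} \<inter> elts P) \<in> elts W} \<inter> elts (vset {y. elts y \<subseteq> elts Y}))"
    by (rule isset_Int) (intro dfn)
  then obtain D where "elts D = {B. vset ({\<sigma>. h \<sigma> \<in> elts B} \<inter> elts P) \<in> elts W} \<inter> {y. elts y \<subseteq> elts Y}"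
    unfolding elts_vset[OF isset_Pow] isset_def by blast
  then have D: "B \<in> elts D \<longleftrightarrow> elts B \<subseteq> elts Y \<and> vset ({\<sigma>. h \<sigma> \<in> elts B} \<inter> elts P) \<in> elts W" for B
    by blast
  have "h ` elts P \<subseteq> elts Y" using h_props by blast
  from complete_ultrafilter_image[OF card W h this D]
  have "belongs (elts D \<inter> M) M" by (rule uf[OF Y(1)])
  then obtain D0 where D0: "D0 \<in> M" "elts D0 = elts D \<inter> M" unfolding belongs_def by blast
  have pre: "elts (vset ({\<sigma>. h \<sigma> \<in> elts B} \<inter> elts P)) = {\<sigma>. h \<sigma> \<in> elts B} \<inter> elts P" for B
    by (intro elts_vset isset_Int) (intro dfn)
  \<comment> \<open>If x = g(\<alpha>), fineness makes almost every \<sigma> contain \<alpha>, and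
    then h(\<sigma>) contains x. Conversely, one h(\<sigma>) containing x is enough, as it is
    included in A.\<close>
  have in_A: "x \<in> elts A \<longleftrightarrow> c \<in> elts D" if c: "elts c = {b \<in> elts Y. x \<in> elts b}" for x c
  proof
    assume "x \<in> elts A"
    then obtain \<alpha> where \<alpha>: "\<alpha> \<in> elts \<mu>" "x = g \<alpha>" using gA by blast
    with fine obtain w where w: "w \<in> elts W" "elts w = {\<sigma> \<in> P_small \<kappa> \<mu>. \<alpha> \<in> elts \<sigma>}"
      unfolding fine_def belongs_def by blast
    have "vset ({\<sigma>. h \<sigma> \<in> elts c} \<inter> elts P) \<in> elts W"
    proof (rule ultrafilter_mono[OF ufW w(1)])
      show "elts w \<subseteq> elts (vset ({\<sigma>. h \<sigma> \<in> elts c} \<inter> elts P))"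
      proof
        fix \<sigma> assume "\<sigma> \<in> elts w"
        then have \<sigma>: "\<sigma> \<in> elts P" "\<alpha> \<in> elts \<sigma>" unfolding w(2) P by blast+
        then have "h \<sigma> \<in> elts c" unfolding c \<alpha>(2) using h_props[OF \<sigma>(1)] by blast
        with \<sigma>(1) show "\<sigma> \<in> elts (vset ({\<sigma>. h \<sigma> \<in> elts c} \<inter> elts P))" unfolding pre by blast
      qed
      show "elts (vset ({\<sigma>. h \<sigma> \<in> elts c} \<inter> elts P)) \<subseteq> elts P" unfolding pre by blast
    qed
    then show "c \<in> elts D" unfolding D c by blast
  next
    assume "c \<in> elts D"
    then have "vset ({\<sigma>. h \<sigma> \<in> elts c} \<inter> elts P) \<in> elts W" unfolding D by blast
    from ultrafilter_nonempty[OF ufW this] obtain \<sigma> where "\<sigma> \<in> elts P" "h \<sigma> \<in> elts c"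
      unfolding pre by blast
    then show "x \<in> elts A" unfolding c using h_props by blast
  qed
  \<comment> \<open>A is recovered inside M from \<open>D0\<close> and \<open>Y\<close>, both
    members of M; \<open>D\<close>, \<open>W\<close> and \<open>h\<close> no longer occur.\<close>
  have "dfn_M (\<lambda>e. \<exists>c\<in>M. c \<in> elts D0 \<and> (\<forall>b\<in>M. b \<in> elts c \<longleftrightarrow> b \<in> elts Y \<and> e 0 \<in> elts b))"
    using D0(1) Y(1) by (intro dfn_M_elts dfn_M_intros)
  from M_separation[OF this X(1)] obtain A' where A': "A' \<in> M"
    "elts A' = {x \<in> elts X. \<exists>c\<in>M. c \<in> elts D0 \<and> (\<forall>b\<in>M. b \<in> elts c \<longleftrightarrow> b \<in> elts Y \<and> x \<in> elts b)}"
    by blast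
  have c_iff: "(\<forall>b\<in>M. b \<in> elts c \<longleftrightarrow> b \<in> elts Y \<and> x \<in> elts b) \<longleftrightarrow> elts c = {b \<in> elts Y. x \<in> elts b}"
    if "c \<in> M" for c x
    using M_elts[OF that] M_elts[OF Y(1)] by auto
  have "elts A' = elts A"
  proof (intro equalityI subsetI)
    fix x assume "x \<in> elts A'"
    then obtain c where "c \<in> M" "c \<in> elts D0" "\<forall>b\<in>M. b \<in> elts c \<longleftrightarrow> b \<in> elts Y \<and> x \<in> elts b"
      unfolding A'(2) by blast
    then show "x \<in> elts A" using in_A[of c x] c_iff[of c x] D0(2) by blast
  next
    fix x assume x: "x \<in> elts A"
    then have xX: "x \<in> elts X" "x \<in> M" using X(2) AM by blast+
    \<comment> \<open>\<open>D0\<close> keeps only the part of \<open>D\<close> in M, so the test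
      set for x has to be found in M.\<close>
    have "dfn_M (\<lambda>e. x \<in> elts (e 0))" using xX(2) by (intro dfn_M_elts dfn_M_intros)
    from M_separation[OF this Y(1)] obtain c where c: "c \<in> M" "elts c = {b \<in> elts Y. x \<in> elts b}" by blast
    have "c \<in> elts D0" using in_A[OF c(2)] x c(1) D0(2) by blast
    moreover have "\<forall>b\<in>M. b \<in> elts c \<longleftrightarrow> b \<in> elts Y \<and> x \<in> elts b" using c_iff[OF c(1)] c(2) by blast
    ultimately show "x \<in> elts A'" unfolding A'(2) using xX(1) c(1) by blast
  qed
  with A'(1) show ?thesis unfolding elts_inject by simp
qed

end

theorem theorem3p17:
  fixes mem :: "'v \<Rightarrow> 'v \<Rightarrow> bool" and M :: "'v set" and \<kappa> :: 'v
  assumes "ZFC UNIV mem M"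
    and "membership.strongly_compact mem \<kappa>"
    and "membership.transitive_class mem M"
    and "membership.proper_class mem M"
    and "ZFC M mem {}"
    and "membership.cover_property mem \<kappa> M"
  shows "membership.approximation_property mem \<kappa> M \<longleftrightarrow>
    (\<forall>X\<in>M. \<forall>U. membership.complete_ultrafilter mem \<kappa> U X \<longrightarrow>
       membership.belongs mem (membership.elts mem U \<inter> M) M)"
proof -
  interpret inner_model mem M
    by unfold_locales (fact assms)+
  have "cardinal \<kappa>" using assms(2) unfolding strongly_compact_def by blast
  then show ?thesis
    using approximation_imp_ultrafilters ultrafilters_imp_approximation[OF assms(2,6)]
    unfolding approximation_property_def by blast
qed

end
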